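(* Let $\tau$ be an infinite cardinal number and let $X$ be a space. Then the following conditions are equivalent: (a) $X$ is normal and $\tau$-paracompact. (b) If $\Phi:X\to \mathscr{F}_{\mathbf c}(\mathbb{J}(\tau))$ is l.s.c., $\theta:X\to \mathscr{C}(\mathbb{J}(\tau))$ is u.s.c. and $\theta<\Phi$, then there exists a continuous mapping $\varphi:X\to \mathscr{C}_{\mathbf c}(\mathbb{J}(\tau))$ such that $\theta<\varphi\leqslant \Phi$.
   Context: All spaces are infinite Hausdorff topological spaces. For a set $Y$, $2^Y$ denotes the family of all nonempty subsets of $Y$. For a space $Y$: $\mathscr{F}(Y)$ is the family of all nonempty closed subsets of $Y$; $\mathscr{C}(Y)$ is the family of all nonempty compact subsets of $Y$; $\mathscr{F}_{\mathbf c}(Y)$ and $\mathscr{C}_{\mathbf c}(Y)$ are the families of connected members of $\mathscr{F}(Y)$ and $\mathscr{C}(Y)$, respectively. A mapping $\Phi:X\to 2^Y$ is l.s.c. (lower semi-continuous) if $\Phi^{-1}(U)=\{x\in X:\Phi(x)\cap U\neq\varnothing\}$ is open in $X$ for every open $U\subseteq Y$; it is u.s.c. (upper semi-continuous) if $\Phi^{-1}(F)$ is closed in $X$ for every closed $F\subseteq Y$; it is continuous if it is both l.s.c. and u.s.c. For $\theta,\Phi:X\to 2^Y$, $\theta\leqslant\Phi$ means $\theta(x)\subseteq\Phi(x)$ for all $x\in X$; $\theta<\Phi$ means $\theta\leqslant\Phi$ and $\Phi(x)\setminus\theta(x)\neq\varnothing$ for all $x\in X$. A space $X$ is $\tau$-paracompact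 if each open cover of $X$ of cardinality $\leq\tau$ has a locally finite open refinement (covering $X$). For a set $\mathscr{A}$, the metrizable hedgehog $\mathbb{J}(\mathscr{A})$ is the set $\{0\}\cup (0,1]\times\mathscr{A}$ with the metric $d(0,\langle s,\alpha\rangle)=s$, $d(\langle s,\alpha\rangle,\langle t,\beta\rangle)=|s-t|$ if $\alpha=\beta$, and $=s+t$ if $\alpha\neq\beta$. $\mathbb{J}(\tau)$ is $\mathbb{J}(\mathscr{A})$ for a set $\mathscr{A}$ of cardinality $\tau$. *)

theory Defs
  imports "HOL-Analysis.Analysis"
begin

unbundle cardinal_syntax

datatype 'b hedgehog_point = Origin | Spine real 'b

definition hedgehog :: "'b set \<Rightarrow> 'b hedgehog_point set" where
  "hedgehog A = {Origin} \<union> {Spine s \<alpha> |s \<alpha>. 0 < s \<and> s \<le> 1 \<and> \<alpha> \<in> A}"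

text \<open>The library's \<open>Metric_space M d\<close> requires \<open>d\<close> to be nonnegative on the whole type, hence the
  absolute values; on the hedgehog itself \<open>\<bar>s\<bar> = s\<close> and \<open>\<bar>s\<bar> + \<bar>t\<bar> = s + t\<close>.\<close>

fun hedgehog_dist :: "'b hedgehog_point \<Rightarrow> 'b hedgehog_point \<Rightarrow> real" where
  "hedgehog_dist Origin Origin = 0"
| "hedgehog_dist Origin (Spine t \<beta>) = \<bar>t\<bar>"
| "hedgehog_dist (Spine s \<alpha>) Origin = \<bar>s\<bar>"
| "hedgehog_dist (Spine s \<alpha>) (Spine t \<beta>) = (if \<alpha> = \<beta> then \<bar>s - t\<bar> else \<bar>s\<bar> + \<bar>t\<bar>)"

lemma Metric_space_hedgehog: "Metric_space (hedgehog A) hedgehog_dist"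
proof
  show "0 \<le> hedgehog_dist x y" for x y :: "'b hedgehog_point"
    by (cases x; cases y) auto
  show "hedgehog_dist x y = hedgehog_dist y x" for x y :: "'b hedgehog_point"
    by (cases x; cases y) auto
  show "hedgehog_dist x y = 0 \<longleftrightarrow> x = y" if "x \<in> hedgehog A" "y \<in> hedgehog A" for x y
    using that by (cases x; cases y) (auto simp: hedgehog_def)
  show "hedgehog_dist x z \<le> hedgehog_dist x y + hedgehog_dist y z"
    for x y z :: "'b hedgehog_point"
    by (cases x; cases y; cases z) auto
qed

definition hedgehog_space :: "'b set \<Rightarrow> 'b hedgehog_point topology" where
  "hedgehog_space A = Metric_space.mtopology (hedgehog A) hedgehog_dist"

lemma topspace_hedgehog_space: "topspace (hedgehog_space A) = hedgehog A"
  by (simp add: hedgehog_space_def Metric_space.topspace_mtopology[OF Metric_space_hedgehog])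

text \<open>A mapping \<open>X \<rightarrow> 2\<^sup>Y\<close> is a function \<open>\<Phi>\<close> on the type of points of \<open>X\<close>; only its values on
  \<open>topspace X\<close> matter, and their nonemptiness is part of \<open>closed_hyp\<close> and \<open>compact_hyp\<close>.\<close>

definition closed_hyp :: "'a topology \<Rightarrow> 'a set set" where
  "closed_hyp Y = {S. S \<noteq> {} \<and> closedin Y S}"

definition compact_hyp :: "'a topology \<Rightarrow> 'a set set" where
  "compact_hyp Y = {S. S \<noteq> {} \<and> compactin Y S}"

definition closed_conn_hyp :: "'a topology \<Rightarrow> 'a set set" where
  "closed_conn_hyp Y = {S \<in> closed_hyp Y. connectedin Y S}"

definition compact_conn_hyp :: "'a topology \<Rightarrow> 'a set set" where
  "compact_conn_hyp Y = {S \<in> compact_hyp Y. connectedin Y S}"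

definition lsc_map :: "'a topology \<Rightarrow> 'b topology \<Rightarrow> ('a \<Rightarrow> 'b set) \<Rightarrow> bool" where
  "lsc_map X Y \<Phi> \<longleftrightarrow> (\<forall>U. openin Y U \<longrightarrow> openin X {x \<in> topspace X. \<Phi> x \<inter> U \<noteq> {}})"

definition usc_map :: "'a topology \<Rightarrow> 'b topology \<Rightarrow> ('a \<Rightarrow> 'b set) \<Rightarrow> bool" where
  "usc_map X Y \<Phi> \<longleftrightarrow> (\<forall>F. closedin Y F \<longrightarrow> closedin X {x \<in> topspace X. \<Phi> x \<inter> F \<noteq> {}})"

definition continuous_set_map :: "'a topology \<Rightarrow> 'b topology \<Rightarrow> ('a \<Rightarrow> 'b set) \<Rightarrow> bool" where
  "continuous_set_map X Y \<Phi> \<longleftrightarrow> lsc_map X Y \<Phi> \<and> usc_map X Y \<Phi>"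

definition selection_le :: "'a topology \<Rightarrow> ('a \<Rightarrow> 'b set) \<Rightarrow> ('a \<Rightarrow> 'b set) \<Rightarrow> bool" where
  "selection_le X \<theta> \<Phi> \<longleftrightarrow> (\<forall>x \<in> topspace X. \<theta> x \<subseteq> \<Phi> x)"

definition selection_less :: "'a topology \<Rightarrow> ('a \<Rightarrow> 'b set) \<Rightarrow> ('a \<Rightarrow> 'b set) \<Rightarrow> bool" where
  "selection_less X \<theta> \<Phi> \<longleftrightarrow> selection_le X \<theta> \<Phi> \<and> (\<forall>x \<in> topspace X. \<Phi> x - \<theta> x \<noteq> {})"

text \<open>Here \<open>\<tau>\<close> is a cardinal in the sense of \<open>Card_order \<tau>\<close>.\<close>

definition card_paracompact_space :: "'c rel \<Rightarrow> 'a topology \<Rightarrow> bool" where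
  "card_paracompact_space \<tau> X \<longleftrightarrow>
    (\<forall>\<U>. (\<forall>U\<in>\<U>. openin X U) \<and> \<Union>\<U> = topspace X \<and> |\<U>| \<le>o \<tau> \<longrightarrow>
      (\<exists>\<V>. (\<forall>V\<in>\<V>. openin X V) \<and> (\<forall>V\<in>\<V>. \<exists>U\<in>\<U>. V \<subseteq> U) \<and> \<Union>\<V> = topspace X \<and>
        locally_finite_in X \<V>))"

end

theory Submission
  imports Defs
begin

text \<open>For (a) \<Rightarrow> (b), strictness is removed first: near each point of \<open>X\<close> some fixed point of the
  hedgehog belongs to \<open>\<Phi> y - \<theta> y\<close>, so along a locally finite closed cover such points can be added to
  \<open>\<theta>\<close>, and it remains to find \<open>\<theta> \<le> \<phi> \<le> \<Phi>\<close>. A compact connected set is either a star at the origin,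
  given by its extents on the spines, or a segment of one spine. The Katetov--Tong theorem is applied
  spine by spine to the extents of \<open>\<theta>\<close> and \<open>\<Phi>\<close>, the latter cut down by locally finite expansions so
  that the resulting family \<open>c\<close> of functions is uniformly small off finitely many spines; this gives a
  continuous family of compact stars. Once more it gives a function \<open>e\<close> between the distances of the
  origin from \<open>\<Phi> x\<close> and from the hull of \<open>\<theta> x\<close>. Where \<open>e\<close> is positive \<open>\<theta> x\<close> lies in a single spine,
  and pushing the star of \<open>c\<close> through the origin by \<open>e x\<close> towards this spine yields \<open>\<phi> x\<close>.

  For (b) \<Rightarrow> (a), maps into one spine separate closed sets, while for an open cover \<open>U\<close> indexed by the
  spines one takes \<open>\<theta> x\<close> to be the origin and \<open>\<Phi> x\<close> the union of the spines \<open>\<alpha>\<close> with \<open>x \<in> U \<alpha>\<close>; the sets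
  where \<open>\<phi> x\<close> extends along \<open>\<alpha>\<close> more than half as far as in any direction refine the cover, locally
  finitely because \<open>\<phi>\<close> is compact-valued and u.s.c.\<close>

subsection \<open>Insertion of continuous functions\<close>

text \<open>Where \<Phi> x misses the origin, a selection needs a lower end as well as an upper one,
  and the spine carrying it is chosen without any continuity in x. Building a full star first and
  moving its centre afterwards avoids splitting X into cases: a push by 0 is the identity for every
  spine, so the choice matters only where \<open>e\<close> is positive, and there it is locally
  constant. Pushing is nonexpansive, so the two operations can be estimated separately. Normality
  alone gives a continuous extent on each spine, but infinitely many such extents need not give
  compact stars or a continuous set-valued map; paracompactness supplies the missing uniformity.
  Since \<tau> is infinite, finite sets of spines and pairs of a rational and a spine are still
  admissible as indices of covers. In the converse direction strictness keeps \<phi> x from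
  collapsing to the origin, so that its largest height is positive and selects a spine.\<close>

lemma openin_lsc_minus_continuous:
  fixes g h :: "'a \<Rightarrow> real"
  assumes g: "\<And>r. openin X {x \<in> topspace X. r < g x}" and h: "continuous_map X euclideanreal h"
  shows "openin X {x \<in> topspace X. r < g x - h x}"
proof -
  have "{x \<in> topspace X. r < g x - h x} =
      (\<Union>q. {x \<in> topspace X. q < g x} \<inter> {x \<in> topspace X. h x < q - r})" (is "?L = ?R")
  proof
    show "?L \<subseteq> ?R"
    proof
      fix x assume x: "x \<in> ?L"
      then obtain q where "h x + r < q" "q < g x"
        using dense[of "h x + r" "g x"] by auto
      with x show "x \<in> ?R"
        by (auto intro!: exI[of _ q])
    qed
  qed auto
  then show ?thesis
    using g h unfolding continuous_map_upper_lower_semicontinuous_lt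
    by (simp add: openin_clauses(3) openin_Int)
qed

text \<open>As in the library's proof of Tietze's theorem, the insertion is a series of Urysohn functions
  whose partial sums violate each of the two inequalities by at most \<open>(2/3) ^ n\<close>.\<close>

theorem Katetov_Tong_insertion:
  fixes f g :: "'a \<Rightarrow> real"
  assumes X: "normal_space X"
    and f: "\<And>r. openin X {x \<in> topspace X. f x < r}"
    and g: "\<And>r. openin X {x \<in> topspace X. r < g x}"
    and fg: "\<And>x. x \<in> topspace X \<Longrightarrow> f x \<le> g x"
    and f1: "\<And>x. x \<in> topspace X \<Longrightarrow> f x \<le> 1"
    and g1: "\<And>x. x \<in> topspace X \<Longrightarrow> -1 \<le> g x"
  shows "\<exists>h. continuous_map X euclideanreal h \<and> (\<forall>x \<in> topspace X. f x \<le> h x \<and> h x \<le> g x)"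
proof -
  define good where "good h n \<longleftrightarrow> continuous_map X euclideanreal h \<and>
      (\<forall>x \<in> topspace X. f x - h x \<le> (2/3)^n \<and> - ((2/3)^n) \<le> g x - h x)"
    for h :: "'a \<Rightarrow> real" and n :: nat
  have step: "\<exists>k. good k (Suc n) \<and> (\<forall>x \<in> topspace X. \<bar>k x - h x\<bar> \<le> (2/3)^n / 3)"
    if h: "good h n" for h n
  proof -
    \<comment> \<open>A third of the current error. The correction \<open>u\<close> lies in [-d, d]
      and is extreme where an inequality fails by at least \<open>d\<close>, so both errors drop
      from 3d to 2d; the two sets where this happens are disjoint because
      \<open>f \<le> g\<close>.\<close>
    define d :: real where "d = (2/3)^n / 3"
    have d: "0 < d" "(2/3)^n = 3 * d" "(2/3)^(Suc n) = 2 * d"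
      by (auto simp: d_def)
    have conth: "continuous_map X euclideanreal h"
      using h by (simp add: good_def)
    have 1: "openin X {x \<in> topspace X. - d < g x - h x}"
      using openin_lsc_minus_continuous[OF g conth] .
    have "openin X {x \<in> topspace X. - d < - f x - - h x}"
      by (intro openin_lsc_minus_continuous continuous_map_minus conth)
        (use f[of "- _"] in \<open>simp add: less_minus_iff\<close>)
    then have 2: "openin X {x \<in> topspace X. f x - h x < d}"
      by (simp add: algebra_simps)
    have "closedin X (topspace X - {x \<in> topspace X. - d < g x - h x})"
      "closedin X (topspace X - {x \<in> topspace X. f x - h x < d})"
      using 1 2 by auto
    moreover have "disjnt (topspace X - {x \<in> topspace X. - d < g x - h x})
        (topspace X - {x \<in> topspace X. f x - h x < d})"
      using fg d(1) unfolding disjnt_iff by (smt (verit) Diff_iff mem_Collect_eq)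
    moreover have "- d \<le> d"
      using d by simp
    ultimately obtain u where u: "continuous_map X (top_of_set {- d..d}) u"
      and ug: "u ` (topspace X - {x \<in> topspace X. - d < g x - h x}) \<subseteq> {- d}"
      and uf: "u ` (topspace X - {x \<in> topspace X. f x - h x < d}) \<subseteq> {d}"
      by (rule Urysohn_lemma[OF X])
    have ud: "\<bar>u x\<bar> \<le> d" if "x \<in> topspace X" for x
    proof -
      have "u x \<in> {- d..d}"
        using u that unfolding continuous_map_in_subtopology by blast
      then show ?thesis
        by (simp add: abs_le_iff minus_le_iff)
    qed
    show ?thesis
    proof (intro exI conjI ballI)
      show "good (\<lambda>x. h x + u x) (Suc n)"
        unfolding good_def
      proof (intro conjI ballI)
        show "continuous_map X euclideanreal (\<lambda>x. h x + u x)"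
          using u conth by (simp add: continuous_map_in_subtopology continuous_map_add)
        fix x assume x: "x \<in> topspace X"
        have hx: "f x - h x \<le> 3 * d" "- (3 * d) \<le> g x - h x"
          using h x d by (auto simp: good_def)
        have ux: "f x - h x < d \<or> u x = d" "- d < g x - h x \<or> u x = - d"
          using uf ug x by (auto simp: image_subset_iff)
        show "f x - (h x + u x) \<le> (2/3) ^ Suc n"
          using hx ux ud[OF x] unfolding d(3) by linarith
        show "- ((2/3) ^ Suc n) \<le> g x - (h x + u x)"
          using hx ux ud[OF x] unfolding d(3) by linarith
      qed
      show "\<bar>h x + u x - h x\<bar> \<le> (2/3)^n / 3" if "x \<in> topspace X" for x
        using ud[OF that] by (simp add: d_def)
    qed
  qed
  have "good (\<lambda>x. 0) 0"
    using f1 g1 by (auto simp: good_def)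
  then have "\<exists>k. \<forall>n. good (k n) n \<and> (\<forall>x \<in> topspace X. \<bar>k (Suc n) x - k n x\<bar> \<le> (2/3)^n / 3)"
    using step by (intro dependent_nat_choice) blast+
  then obtain k where k: "\<And>n. good (k n) n"
    "\<And>n x. x \<in> topspace X \<Longrightarrow> \<bar>k (Suc n) x - k n x\<bar> \<le> (2/3)^n / 3"
    by blast
  \<comment> \<open>The increments \<open>(2/3)^n / 3\<close> are exactly the differences of
    consecutive powers, so their sums telescope.\<close>
  have tail: "\<bar>k (n + m) x - k n x\<bar> \<le> (2/3)^n - (2/3)^(n + m)" if "x \<in> topspace X" for n m x
  proof (induction m)
    case (Suc m)
    have "\<bar>a - c\<bar> \<le> q - p * (2/3)" if "\<bar>a - b\<bar> \<le> p / 3" "\<bar>b - c\<bar> \<le> q - p" for a b c p q :: real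
      using that by linarith
    from this[OF k(2)[OF that, of "n + m"] Suc] show ?case
      by (simp add: mult.commute)
  qed auto
  have close: "\<bar>k m x - k n x\<bar> \<le> (2/3)^n" if "x \<in> topspace X" "m \<ge> n" for n m x
  proof -
    have "\<bar>k m x - k n x\<bar> \<le> (2/3)^n - (2/3)^m"
      using tail[OF that(1), of n "m - n"] that(2) by simp
    moreover have "0 \<le> (2/3::real)^m"
      by simp
    ultimately show ?thesis
      by linarith
  qed
  have "(\<lambda>n. (2/3::real)^n) \<longlonglongrightarrow> 0"
    by (intro LIMSEQ_power_zero) auto
  have ev: "\<forall>\<^sub>F n in sequentially. (2/3::real)^n < e" if "e > 0" for e
    using order_tendstoD(2)[OF \<open>(\<lambda>n. (2/3::real)^n) \<longlonglongrightarrow> 0\<close> that] .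
  have conv: "convergent (\<lambda>n. k n x)" if x: "x \<in> topspace X" for x
  proof (rule Cauchy_convergent, rule metric_CauchyI)
    fix e :: real assume "e > 0"
    then obtain N where N: "(2/3::real)^N < e / 2"
      using ev[of "e / 2"] eventually_happens'[OF sequentially_bot] by auto
    have "dist (k m x) (k n x) < e" if "m \<ge> N" "n \<ge> N" for m n
      using close[OF x that(1)] close[OF x that(2)] N unfolding dist_real_def by linarith
    then show "\<exists>M. \<forall>m\<ge>M. \<forall>n\<ge>M. dist (k m x) (k n x) < e"
      by blast
  qed
  define h where "h x = lim (\<lambda>n. k n x)" for x
  have lim: "(\<lambda>n. k n x) \<longlonglongrightarrow> h x" if "x \<in> topspace X" for x
    using conv[OF that] by (simp add: h_def convergent_LIMSEQ_iff)
  have near: "\<bar>k n x - h x\<bar> \<le> (2/3)^n" if x: "x \<in> topspace X" for n x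
  proof (rule LIMSEQ_le_const2)
    show "(\<lambda>m. \<bar>k n x - k m x\<bar>) \<longlonglongrightarrow> \<bar>k n x - h x\<bar>"
      by (intro tendsto_intros lim x)
    show "\<exists>N. \<forall>m\<ge>N. \<bar>k n x - k m x\<bar> \<le> (2/3)^n"
      using close[OF x] by (metis abs_minus_commute)
  qed
  have "continuous_map X Met_TC.mtopology h"
  proof (rule Met_TC.continuous_map_uniform_limit)
    show "\<forall>\<^sub>F n in sequentially. continuous_map X Met_TC.mtopology (k n)"
      using k(1) by (simp add: good_def)
    show "\<forall>\<^sub>F n in sequentially. \<forall>x\<in>topspace X. h x \<in> UNIV \<and> dist (k n x) (h x) < e"
      if "e > 0" for e
      using ev[OF that]
    proof eventually_elim
      case (elim n)
      then show ?case
        using near by (auto simp: dist_real_def intro: order.strict_trans1)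
    qed
  qed auto
  moreover have "f x \<le> h x \<and> h x \<le> g x" if x: "x \<in> topspace X" for x
  proof
    show "f x \<le> h x"
    proof (rule field_le_epsilon)
      fix e :: real assume "e > 0"
      then obtain n where "(2/3::real)^n < e / 2"
        using ev[of "e / 2"] eventually_happens'[OF sequentially_bot] by auto
      moreover have "f x - k n x \<le> (2/3)^n"
        using k(1)[of n] x by (simp add: good_def)
      ultimately show "f x \<le> h x + e"
        using near[OF x, of n] by linarith
    qed
    show "h x \<le> g x"
    proof (rule field_le_epsilon)
      fix e :: real assume "e > 0"
      then obtain n where "(2/3::real)^n < e / 2"
        using ev[of "e / 2"] eventually_happens'[OF sequentially_bot] by auto
      moreover have "- ((2/3)^n) \<le> g x - k n x"
        using k(1)[of n] x by (simp add: good_def)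
      ultimately show "h x \<le> g x + e"
        using near[OF x, of n] by linarith
    qed
  qed
  ultimately show ?thesis
    by auto
qed

subsection \<open>Locally finite refinements and expansions\<close>

text \<open>Counts indices rather than distinct sets, since different spines may carry the same set;
  only empty members come for free.\<close>

definition locally_finite_family :: "'a topology \<Rightarrow> 'i set \<Rightarrow> ('i \<Rightarrow> 'a set) \<Rightarrow> bool" where
  "locally_finite_family X I E \<longleftrightarrow>
    (\<forall>x \<in> topspace X. \<exists>N. openin X N \<and> x \<in> N \<and> finite {i \<in> I. E i \<inter> N \<noteq> {}})"

lemma locally_finite_familyD:
  assumes "locally_finite_family X I E" "x \<in> topspace X"
  obtains N where "openin X N" "x \<in> N" "finite {i \<in> I. E i \<inter> N \<noteq> {}}"
  using bspec[OF assms[unfolded locally_finite_family_def]] by (elim exE conjE)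

lemma locally_finite_family_imp_locally_finite_in:
  assumes "locally_finite_family X I E" "\<And>i. i \<in> I \<Longrightarrow> E i \<subseteq> topspace X"
  shows "locally_finite_in X (E ` I)"
  unfolding locally_finite_in_def
proof (intro conjI ballI)
  fix x assume "x \<in> topspace X"
  then obtain N where N: "openin X N" "x \<in> N" "finite {i \<in> I. E i \<inter> N \<noteq> {}}"
    by (rule locally_finite_familyD[OF assms(1)])
  have "{U \<in> E ` I. U \<inter> N \<noteq> {}} = E ` {i \<in> I. E i \<inter> N \<noteq> {}}"
    by auto
  with N show "\<exists>V. openin X V \<and> x \<in> V \<and> finite {U \<in> E ` I. U \<inter> V \<noteq> {}}"
    by (intro exI[of _ N]) simp
qed (use assms(2) in auto)

lemma locally_finite_family_mono:
  assumes "locally_finite_family X I E" "J \<subseteq> I" "\<And>i. i \<in> J \<Longrightarrow> F i \<subseteq> E i"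
  shows "locally_finite_family X J F"
  unfolding locally_finite_family_def
proof
  fix x assume "x \<in> topspace X"
  then obtain N where N: "openin X N" "x \<in> N" "finite {i \<in> I. E i \<inter> N \<noteq> {}}"
    by (rule locally_finite_familyD[OF assms(1)])
  have "{i \<in> J. F i \<inter> N \<noteq> {}} \<subseteq> {i \<in> I. E i \<inter> N \<noteq> {}}"
    using assms(2,3) by blast
  with N show "\<exists>N. openin X N \<and> x \<in> N \<and> finite {i \<in> J. F i \<inter> N \<noteq> {}}"
    using finite_subset by blast
qed

lemma locally_finite_family_closure:
  assumes "locally_finite_family X I E"
  shows "locally_finite_family X I (\<lambda>i. X closure_of E i)"
  unfolding locally_finite_family_def
proof
  fix x assume "x \<in> topspace X"
  then obtain N where N: "openin X N" "x \<in> N" "finite {i \<in> I. E i \<inter> N \<noteq> {}}"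
    by (rule locally_finite_familyD[OF assms])
  have "X closure_of E i \<inter> N = {} \<longleftrightarrow> E i \<inter> N = {}" for i
    using openin_Int_closure_of_eq_empty[OF N(1)] by (simp add: Int_commute)
  with N show "\<exists>N. openin X N \<and> x \<in> N \<and> finite {i \<in> I. X closure_of E i \<inter> N \<noteq> {}}"
    by (intro exI[of _ N]) simp
qed

lemma closedin_UN_locally_finite:
  assumes "locally_finite_family X I E" "\<And>i. i \<in> I \<Longrightarrow> closedin X (E i)"
  shows "closedin X (\<Union>i\<in>I. E i)"
proof (rule closedin_locally_finite_Union)
  show "locally_finite_in X (E ` I)"
    by (intro locally_finite_family_imp_locally_finite_in assms closedin_subset)
qed (use assms(2) in auto)

text \<open>Finite subsets are sorted by size: those of size n + 1 arise by \<open>insert\<close>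
  from pairs, and an infinite cardinal absorbs pairs and countable unions. This admits covers
  indexed by the finite sets of indices that a neighbourhood can meet.\<close>

lemma ordLeq_finite_subsets:
  assumes r: "Cinfinite r" and I: "|I| \<le>o r"
  shows "|{J. J \<subseteq> I \<and> finite J}| \<le>o r"
proof -
  have inf: "infinite (Field r)" and card: "Card_order r"
    using r by (auto simp: cinfinite_def)
  have nat: "|UNIV :: nat set| \<le>o r"
    using inf card infinite_iff_card_of_nat card_of_Field_ordIso ordLeq_ordIso_trans by blast
  define S where "S n = {J. J \<subseteq> I \<and> finite J \<and> card J = n}" for n
  have S: "|S n| \<le>o r" for n
  proof (induction n)
    case 0
    have "S 0 = {{}}"
      by (auto simp: S_def)
    then have "|S 0| \<le>o |UNIV :: nat set|"
      by (intro card_of_ordLeqI[of "\<lambda>_. 0"]) auto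
    then show ?case
      using nat ordLeq_transitive by blast
  next
    case (Suc n)
    have "S (Suc n) \<subseteq> (\<lambda>(i, J). insert i J) ` (I \<times> S n)"
    proof
      fix J assume "J \<in> S (Suc n)"
      then obtain i J' where "J = insert i J'" "i \<notin> J'" "finite J'" "card J' = n" "J \<subseteq> I"
        by (auto simp: S_def card_Suc_eq_finite)
      then show "J \<in> (\<lambda>(i, J). insert i J) ` (I \<times> S n)"
        by (force simp: S_def)
    qed
    then have "|S (Suc n)| \<le>o |I \<times> S n|"
      using card_of_mono1 card_of_image ordLeq_transitive by blast
    then show ?case
      using card_of_Times_ordLeq_infinite_Field[OF inf I Suc.IH card] ordLeq_transitive by blast
  qed
  have "{J. J \<subseteq> I \<and> finite J} = (\<Union>n. S n)"
    by (auto simp: S_def)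
  then show ?thesis
    using card_of_UNION_ordLeq_infinite_Field[OF inf card nat, of S] S by simp
qed

text \<open>The members of a refinement are grouped by a chosen index whose set contains them. A
  neighbourhood meeting finitely many members meets at most as many groups, so local finiteness
  passes to the indices.\<close>

lemma card_paracompact_space_indexed_refinement:
  assumes X: "card_paracompact_space \<tau> X" and I: "|I| \<le>o \<tau>"
    and U: "\<And>i. i \<in> I \<Longrightarrow> openin X (U i)" and cov: "topspace X \<subseteq> (\<Union>i\<in>I. U i)"
  obtains V where "\<And>i. i \<in> I \<Longrightarrow> openin X (V i) \<and> V i \<subseteq> U i"
    "topspace X \<subseteq> (\<Union>i\<in>I. V i)" "locally_finite_family X I V"
proof -
  have "|U ` I| \<le>o \<tau>"
    using card_of_image I ordLeq_transitive by blast
  moreover have "\<Union>(U ` I) = topspace X"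
    using cov U openin_subset by blast
  moreover have "\<forall>W\<in>U ` I. openin X W"
    using U by blast
  ultimately have "\<exists>\<V>. (\<forall>V\<in>\<V>. openin X V) \<and> (\<forall>V\<in>\<V>. \<exists>W\<in>U ` I. V \<subseteq> W) \<and> \<Union>\<V> = topspace X \<and>
      locally_finite_in X \<V>"
    using spec[OF X[unfolded card_paracompact_space_def], of "U ` I"] by simp
  then obtain \<V> where \<V>: "\<forall>V\<in>\<V>. openin X V" "\<forall>V\<in>\<V>. \<exists>W\<in>U ` I. V \<subseteq> W"
    "\<Union>\<V> = topspace X" "locally_finite_in X \<V>"
    by (elim exE conjE)
  from \<V>(2) have "\<forall>V\<in>\<V>. \<exists>i. i \<in> I \<and> V \<subseteq> U i"
    by blast
  from bchoice[OF this] obtain k where k: "\<forall>V\<in>\<V>. k V \<in> I \<and> V \<subseteq> U (k V)"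
    by (elim exE)
  define W where "W i = \<Union>{V \<in> \<V>. k V = i}" for i
  show thesis
  proof
    show "openin X (W i) \<and> W i \<subseteq> U i" if "i \<in> I" for i
      using \<V>(1) k by (auto simp: W_def)
    show "topspace X \<subseteq> (\<Union>i\<in>I. W i)"
    proof
      fix x assume "x \<in> topspace X"
      then obtain V where "V \<in> \<V>" "x \<in> V"
        using \<V>(3) by blast
      then show "x \<in> (\<Union>i\<in>I. W i)"
        using k by (auto simp: W_def intro!: bexI[of _ "k V"])
    qed
    show "locally_finite_family X I W"
      unfolding locally_finite_family_def
    proof
      fix x assume "x \<in> topspace X"
      then obtain N where N: "openin X N" "x \<in> N" "finite {V \<in> \<V>. V \<inter> N \<noteq> {}}"
        using \<V>(4) unfolding locally_finite_in_def by blast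
      have "{i \<in> I. W i \<inter> N \<noteq> {}} \<subseteq> k ` {V \<in> \<V>. V \<inter> N \<noteq> {}}"
        by (auto simp: W_def)
      then show "\<exists>N. openin X N \<and> x \<in> N \<and> finite {i \<in> I. W i \<inter> N \<noteq> {}}"
        using N finite_subset[OF _ finite_imageI[OF N(3)]] by blast
    qed
  qed
qed

text \<open>The part of \<open>C\<close> that the other sets leave to \<open>U i\<close> is closed,
  so normality surrounds it by an open \<open>V\<close> with closure in \<open>U i\<close>; the rest
  \<open>C - V\<close> needs one set less. The clause \<open>K i \<subseteq> C\<close> keeps the
  pieces locally finite when many sets \<open>C\<close> are split at once.\<close>

lemma normal_space_finite_closed_split:
  assumes X: "normal_space X" and "finite J" "\<And>i. i \<in> J \<Longrightarrow> openin X (U i)"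
    and "closedin X C" "C \<subseteq> (\<Union>i\<in>J. U i)"
  shows "\<exists>K. (\<forall>i\<in>J. closedin X (K i) \<and> K i \<subseteq> U i \<and> K i \<subseteq> C) \<and> C \<subseteq> (\<Union>i\<in>J. K i)"
  using assms(2-)
proof (induction J arbitrary: C rule: finite_induct)
  case (insert i J)
  let ?D = "C - (\<Union>j\<in>J. U j)"
  have "closedin X ?D" "?D \<subseteq> U i" "openin X (U i)"
    using insert.prems by (auto intro!: closedin_diff)
  then obtain V where V: "openin X V" "?D \<subseteq> V" "X closure_of V \<subseteq> U i"
    using X unfolding normal_space_alt by meson
  have "closedin X (C - V)" "C - V \<subseteq> (\<Union>j\<in>J. U j)"
    using V insert.prems by (auto intro!: closedin_diff)
  then obtain K where K: "\<forall>j\<in>J. closedin X (K j) \<and> K j \<subseteq> U j \<and> K j \<subseteq> C - V"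
    "C - V \<subseteq> (\<Union>j\<in>J. K j)"
    using insert.IH[of "C - V"] insert.prems by auto
  have "closedin X (X closure_of V \<inter> C)" "C \<inter> V \<subseteq> X closure_of V"
    using insert.prems closure_of_subset[OF openin_subset[OF V(1)]] by auto
  then show ?case
    using K V insert.hyps
    by (intro exI[of _ "K(i := X closure_of V \<inter> C)"]) (auto split: if_splits)
qed auto

text \<open>Refining a locally finite open cover \<open>V\<close> once more, by the interiors of the closed sets that
  meet only finitely many of the \<open>V i\<close>, replaces the transfinite shrinking of \<open>V\<close> by finite ones.\<close>

lemma normal_card_paracompact_closed_refinement:
  assumes X: "normal_space X" "card_paracompact_space \<tau> X" and \<tau>: "Cinfinite \<tau>"
    and I: "|I| \<le>o \<tau>"
    and U: "\<And>i. i \<in> I \<Longrightarrow> openin X (U i)" and cov: "topspace X \<subseteq> (\<Union>i\<in>I. U i)"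
  obtains K where "\<And>i. i \<in> I \<Longrightarrow> closedin X (K i) \<and> K i \<subseteq> U i"
    "topspace X \<subseteq> (\<Union>i\<in>I. K i)" "locally_finite_family X I K"
proof -
  obtain V where V: "\<And>i. i \<in> I \<Longrightarrow> openin X (V i) \<and> V i \<subseteq> U i"
    "topspace X \<subseteq> (\<Union>i\<in>I. V i)" "locally_finite_family X I V"
    using card_paracompact_space_indexed_refinement[OF X(2) I U cov] by (metis (lifting))
  define \<J> where "\<J> = {J. J \<subseteq> I \<and> finite J}"
  have card_J: "|\<J>| \<le>o \<tau>"
    unfolding \<J>_def by (rule ordLeq_finite_subsets[OF \<tau> I])
  \<comment> \<open>The points that lie in no \<open>V i\<close> with i outside \<open>J\<close>. As
    \<open>V\<close> covers, \<open>F J\<close> lies in the union over the finite set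
    \<open>J\<close>, so its cover can be shrunk by normality alone.\<close>
  define F where "F J = topspace X - (\<Union>i\<in>I-J. V i)" for J
  have clF: "closedin X (F J)" for J
    unfolding F_def using V(1) by (intro closedin_diff openin_Union) auto
  have covF: "topspace X \<subseteq> (\<Union>J\<in>\<J>. X interior_of F J)"
  proof
    fix x assume "x \<in> topspace X"
    then obtain N where N: "openin X N" "x \<in> N" "finite {i \<in> I. V i \<inter> N \<noteq> {}}"
      by (rule locally_finite_familyD[OF V(3)])
    then have "N \<subseteq> F {i \<in> I. V i \<inter> N \<noteq> {}}"
      using openin_subset by (fastforce simp: F_def)
    then have "x \<in> X interior_of F {i \<in> I. V i \<inter> N \<noteq> {}}"
      using N unfolding interior_of_def by blast
    moreover have "{i \<in> I. V i \<inter> N \<noteq> {}} \<in> \<J>"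
      using N by (simp add: \<J>_def)
    ultimately show "x \<in> (\<Union>J\<in>\<J>. X interior_of F J)"
      by (rule UN_I[rotated])
  qed
  obtain W where W: "\<And>J. J \<in> \<J> \<Longrightarrow> openin X (W J) \<and> W J \<subseteq> X interior_of F J"
    "topspace X \<subseteq> (\<Union>J\<in>\<J>. W J)" "locally_finite_family X \<J> W"
    by (rule card_paracompact_space_indexed_refinement[OF X(2) card_J openin_interior_of covF], rule that) auto
  have split: "\<exists>K. (\<forall>i\<in>J. closedin X (K i) \<and> K i \<subseteq> V i \<and> K i \<subseteq> X closure_of W J) \<and>
      X closure_of W J \<subseteq> (\<Union>i\<in>J. K i)" if J: "J \<in> \<J>" for J
  proof (rule normal_space_finite_closed_split[OF X(1)])
    have "X closure_of W J \<subseteq> F J"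
      using W(1)[OF J] clF interior_of_subset by (metis closure_of_minimal subset_trans)
    also have "F J \<subseteq> (\<Union>i\<in>J. V i)"
      using V(2) by (auto simp: F_def)
    finally show "X closure_of W J \<subseteq> (\<Union>i\<in>J. V i)" .
  qed (use J V in \<open>auto simp: \<J>_def\<close>)
  obtain K where K: "\<And>J i. J \<in> \<J> \<Longrightarrow> i \<in> J \<Longrightarrow>
      closedin X (K J i) \<and> K J i \<subseteq> V i \<and> K J i \<subseteq> X closure_of W J"
    "\<And>J. J \<in> \<J> \<Longrightarrow> X closure_of W J \<subseteq> (\<Union>i\<in>J. K J i)"
    using split by metis
  \<comment> \<open>Each \<open>K J i\<close> lies in the closure of \<open>W J\<close>, so this
    possibly infinite union is locally finite and hence closed; local finiteness in i comes from
    \<open>L i \<subseteq> V i\<close>.\<close>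
  define L where "L i = (\<Union>J\<in>{J\<in>\<J>. i \<in> J}. K J i)" for i
  have LV: "L i \<subseteq> V i" for i
    using K(1) by (auto simp: L_def)
  show thesis
  proof
    show "closedin X (L i) \<and> L i \<subseteq> U i" if "i \<in> I" for i
    proof
      show "closedin X (L i)"
        unfolding L_def
        by (intro closedin_UN_locally_finite
            locally_finite_family_mono[OF locally_finite_family_closure[OF W(3)]])
          (use K(1) in auto)
      show "L i \<subseteq> U i"
        using LV V(1)[OF that] by blast
    qed
    show "locally_finite_family X I L"
      by (rule locally_finite_family_mono[OF V(3) subset_refl LV])
    show "topspace X \<subseteq> (\<Union>i\<in>I. L i)"
    proof
      fix x assume "x \<in> topspace X"
      then obtain J where J: "J \<in> \<J>" "x \<in> W J"
        using W(2) by blast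
      then have "x \<in> X closure_of W J"
        using W(1)[OF J(1)] closure_of_subset[OF openin_subset] by blast
      then obtain i where "i \<in> J" "x \<in> K J i"
        using K(2)[OF J(1)] by blast
      then show "x \<in> (\<Union>i\<in>I. L i)"
        using J by (auto simp: L_def \<J>_def)
    qed
  qed
qed

text \<open>The points avoiding all \<open>E i\<close> with i outside a finite \<open>J\<close> form
  an open set \<open>G J\<close>, and these sets cover. If \<open>K\<close> is a locally finite
  closed refinement and \<open>U i\<close> omits the \<open>K J\<close> disjoint from
  \<open>E i\<close>, then \<open>U i\<close> meets \<open>K J\<close> only for i in
  \<open>J\<close>; so a neighbourhood meeting finitely many \<open>K J\<close> meets finitely many
  \<open>U i\<close>.\<close>

lemma normal_card_paracompact_open_expansion:
  assumes X: "normal_space X" "card_paracompact_space \<tau> X" and \<tau>: "Cinfinite \<tau>"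
    and I: "|I| \<le>o \<tau>" and E: "\<And>i. i \<in> I \<Longrightarrow> closedin X (E i)" "locally_finite_family X I E"
  shows "\<exists>U. (\<forall>i\<in>I. openin X (U i) \<and> E i \<subseteq> U i) \<and> locally_finite_family X I U"
proof -
  define \<J> where "\<J> = {J. J \<subseteq> I \<and> finite J}"
  have card_J: "|\<J>| \<le>o \<tau>"
    unfolding \<J>_def by (rule ordLeq_finite_subsets[OF \<tau> I])
  define G where "G J = topspace X - (\<Union>i\<in>I-J. E i)" for J
  have openG: "openin X (G J)" for J
    unfolding G_def
    by (intro openin_diff openin_topspace closedin_UN_locally_finite
        locally_finite_family_mono[OF E(2)]) (use E in auto)
  have covG: "topspace X \<subseteq> (\<Union>J\<in>\<J>. G J)"
  proof
    fix x assume x: "x \<in> topspace X"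
    then obtain N where N: "openin X N" "x \<in> N" "finite {i \<in> I. E i \<inter> N \<noteq> {}}"
      by (rule locally_finite_familyD[OF E(2)])
    then show "x \<in> (\<Union>J\<in>\<J>. G J)"
      using x by (intro UN_I[of "{i \<in> I. E i \<inter> N \<noteq> {}}"]) (auto simp: G_def \<J>_def)
  qed
  obtain K where K: "\<And>J. J \<in> \<J> \<Longrightarrow> closedin X (K J) \<and> K J \<subseteq> G J"
    "topspace X \<subseteq> (\<Union>J\<in>\<J>. K J)" "locally_finite_family X \<J> K"
    by (rule normal_card_paracompact_closed_refinement[OF X \<tau> card_J openG covG], rule that) auto
  define U where "U i = topspace X - (\<Union>J\<in>{J\<in>\<J>. K J \<inter> E i = {}}. K J)" for i
  show ?thesis
  proof (rule exI[of _ U], rule conjI, rule ballI)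
    fix i assume i: "i \<in> I"
    show "openin X (U i) \<and> E i \<subseteq> U i"
    proof
      show "openin X (U i)"
        unfolding U_def
        by (intro openin_diff openin_topspace closedin_UN_locally_finite
            locally_finite_family_mono[OF K(3)]) (use K(1) in auto)
      show "E i \<subseteq> U i"
        using E(1)[OF i] closedin_subset by (fastforce simp: U_def)
    qed
  next
    show "locally_finite_family X I U"
      unfolding locally_finite_family_def
    proof
      fix x assume "x \<in> topspace X"
      then obtain N where N: "openin X N" "x \<in> N" "finite {J \<in> \<J>. K J \<inter> N \<noteq> {}}"
        by (rule locally_finite_familyD[OF K(3)])
      have "{i \<in> I. U i \<inter> N \<noteq> {}} \<subseteq> \<Union>{J \<in> \<J>. K J \<inter> N \<noteq> {}}"
      proof
        fix i assume "i \<in> {i \<in> I. U i \<inter> N \<noteq> {}}"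
        then obtain y where y: "i \<in> I" "y \<in> U i" "y \<in> N"
          by blast
        then obtain J where J: "J \<in> \<J>" "y \<in> K J"
          using K(2) by (auto simp: U_def)
        then have "K J \<inter> E i \<noteq> {}"
          using y by (auto simp: U_def)
        then have "i \<in> J"
          using K(1)[OF J(1)] y by (auto simp: G_def)
        then show "i \<in> \<Union>{J \<in> \<J>. K J \<inter> N \<noteq> {}}"
          using J y by blast
      qed
      moreover have "finite (\<Union>{J \<in> \<J>. K J \<inter> N \<noteq> {}})"
        using N(3) by (auto simp: \<J>_def)
      ultimately show "\<exists>N. openin X N \<and> x \<in> N \<and> finite {i \<in> I. U i \<inter> N \<noteq> {}}"
        using N finite_subset by blast
    qed
  qed
qed

subsection \<open>Geometry of the hedgehog\<close>

text \<open>The two halves of closeness in the Hausdorff sense give the two semicontinuities. For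
  the lower one a ball around a single point of \<open>\<phi> x\<close> suffices; the upper one
  needs one radius for all points of \<open>\<phi> x\<close>, which compactness provides as a
  Lebesgue number.\<close>

lemma (in Metric_space) continuous_set_map_metricI:
  assumes comp: "\<And>x. x \<in> topspace X \<Longrightarrow> compactin mtopology (\<phi> x)"
    and near: "\<And>x \<epsilon>. x \<in> topspace X \<Longrightarrow> 0 < \<epsilon> \<Longrightarrow> \<exists>N. openin X N \<and> x \<in> N \<and> (\<forall>y\<in>N.
      (\<forall>p\<in>\<phi> x. \<exists>q\<in>\<phi> y. d p q < \<epsilon>) \<and> (\<forall>q\<in>\<phi> y. \<exists>p\<in>\<phi> x. d p q < \<epsilon>))"
  shows "continuous_set_map X mtopology \<phi>"
  unfolding continuous_set_map_def
proof
  have sub: "\<phi> x \<subseteq> M" if "x \<in> topspace X" for x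
    using comp[OF that] compactin_subset_topspace by fastforce
  show "lsc_map X mtopology \<phi>"
    unfolding lsc_map_def
  proof (intro allI impI)
    fix U assume U: "openin mtopology U"
    show "openin X {x \<in> topspace X. \<phi> x \<inter> U \<noteq> {}}"
    proof (subst openin_subopen, intro ballI)
      fix x assume "x \<in> {x \<in> topspace X. \<phi> x \<inter> U \<noteq> {}}"
      then obtain p where x: "x \<in> topspace X" and p: "p \<in> \<phi> x" "p \<in> U"
        by blast
      obtain r where r: "r > 0" "mball p r \<subseteq> U"
        using U p(2) unfolding openin_mtopology by blast
      obtain N where N: "openin X N" "x \<in> N" "\<forall>y\<in>N.
          (\<forall>p\<in>\<phi> x. \<exists>q\<in>\<phi> y. d p q < r) \<and> (\<forall>q\<in>\<phi> y. \<exists>p\<in>\<phi> x. d p q < r)"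
        using near[OF x r(1)] by (elim exE conjE)
      have "N \<subseteq> {x \<in> topspace X. \<phi> x \<inter> U \<noteq> {}}"
      proof
        fix y assume y: "y \<in> N"
        then have yX: "y \<in> topspace X"
          using openin_subset[OF N(1)] by blast
        obtain q where "q \<in> \<phi> y" "d p q < r"
          using N(3) y p(1) by blast
        then have "q \<in> mball p r"
          using sub[OF x] sub[OF yX] p by auto
        then show "y \<in> {x \<in> topspace X. \<phi> x \<inter> U \<noteq> {}}"
          using \<open>q \<in> \<phi> y\<close> r yX by blast
      qed
      then show "\<exists>T. openin X T \<and> x \<in> T \<and> T \<subseteq> {x \<in> topspace X. \<phi> x \<inter> U \<noteq> {}}"
        using N by blast
    qed
  qed
  show "usc_map X mtopology \<phi>"
    unfolding usc_map_def
  proof (intro allI impI)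
    fix F assume F: "closedin mtopology F"
    have "openin X {x \<in> topspace X. \<phi> x \<inter> F = {}}"
    proof (subst openin_subopen, intro ballI)
      fix x assume "x \<in> {x \<in> topspace X. \<phi> x \<inter> F = {}}"
      then have x: "x \<in> topspace X" "\<phi> x \<inter> F = {}"
        by auto
      have "openin mtopology (M - F)"
        using F by (simp add: closedin_def)
      then obtain r where r: "r > 0" "\<forall>p\<in>\<phi> x. mball p r \<subseteq> M - F"
        using lebesgue_number[OF comp[OF x(1)], of "{M - F}"] sub[OF x(1)] x(2) by auto
      obtain N where N: "openin X N" "x \<in> N" "\<forall>y\<in>N.
          (\<forall>p\<in>\<phi> x. \<exists>q\<in>\<phi> y. d p q < r) \<and> (\<forall>q\<in>\<phi> y. \<exists>p\<in>\<phi> x. d p q < r)"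
        using near[OF x(1) r(1)] by (elim exE conjE)
      have "N \<subseteq> {x \<in> topspace X. \<phi> x \<inter> F = {}}"
      proof
        fix y assume y: "y \<in> N"
        then have yX: "y \<in> topspace X"
          using openin_subset[OF N(1)] by blast
        have "q \<notin> F" if q: "q \<in> \<phi> y" for q
        proof -
          obtain p where "p \<in> \<phi> x" "d p q < r"
            using N(3) y q by blast
          then have "q \<in> mball p r"
            using sub[OF x(1)] sub[OF yX] q by auto
          then show ?thesis
            using r \<open>p \<in> \<phi> x\<close> by blast
        qed
        then show "y \<in> {x \<in> topspace X. \<phi> x \<inter> F = {}}"
          using yX by blast
      qed
      then show "\<exists>T. openin X T \<and> x \<in> T \<and> T \<subseteq> {x \<in> topspace X. \<phi> x \<inter> F = {}}"
        using N by blast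
    qed
    moreover have "topspace X - {x \<in> topspace X. \<phi> x \<inter> F \<noteq> {}} = {x \<in> topspace X. \<phi> x \<inter> F = {}}"
      by blast
    ultimately show "closedin X {x \<in> topspace X. \<phi> x \<inter> F \<noteq> {}}"
      unfolding closedin_def by auto
  qed
qed

lemma lsc_map_openin_meets:
  "lsc_map X Y \<Phi> \<Longrightarrow> openin Y U \<Longrightarrow> openin X {x \<in> topspace X. \<Phi> x \<inter> U \<noteq> {}}"
  by (simp add: lsc_map_def)

lemma usc_map_openin_subset:
  assumes "usc_map X Y \<theta>" "openin Y U" "\<And>x. x \<in> topspace X \<Longrightarrow> \<theta> x \<subseteq> topspace Y"
  shows "openin X {x \<in> topspace X. \<theta> x \<subseteq> U}"
proof -
  have "closedin X {x \<in> topspace X. \<theta> x \<inter> (topspace Y - U) \<noteq> {}}"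
    using assms(1,2) unfolding usc_map_def by blast
  then have "openin X (topspace X - {x \<in> topspace X. \<theta> x \<inter> (topspace Y - U) \<noteq> {}})"
    by blast
  moreover have "topspace X - {x \<in> topspace X. \<theta> x \<inter> (topspace Y - U) \<noteq> {}} = {x \<in> topspace X. \<theta> x \<subseteq> U}"
    using assms(3) by blast
  ultimately show ?thesis
    by simp
qed

text \<open>The coordinate of a point on the line obtained by folding all spines other than \<open>\<alpha>\<close> onto the
  negative half-axis. A nonnegative coordinate determines the point, which turns the intermediate
  value theorem into a statement about connected subsets of the hedgehog.\<close>

definition coord :: "'b \<Rightarrow> 'b hedgehog_point \<Rightarrow> real" where
  "coord \<alpha> p = (case p of Origin \<Rightarrow> 0 | Spine s \<beta> \<Rightarrow> if \<beta> = \<alpha> then s else - s)"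

text \<open>Parametrizes a spine together with the origin: \<open>Spine 0 \<alpha>\<close> is not a
  point of the hedgehog, so height 0 has to be sent to \<open>Origin\<close>.\<close>

definition spine_point :: "'b \<Rightarrow> real \<Rightarrow> 'b hedgehog_point" where
  "spine_point \<alpha> r = (if r = 0 then Origin else Spine r \<alpha>)"

abbreviation height :: "'b hedgehog_point \<Rightarrow> real" where
  "height p \<equiv> hedgehog_dist Origin p"

lemma coord_simps [simp]:
  "coord \<alpha> Origin = 0" "coord \<alpha> (Spine s \<beta>) = (if \<beta> = \<alpha> then s else - s)"
  by (auto simp: coord_def)

lemma Origin_in_hedgehog [simp]: "Origin \<in> hedgehog A"
  by (simp add: hedgehog_def)

lemma Spine_in_hedgehog [simp]: "Spine s \<alpha> \<in> hedgehog A \<longleftrightarrow> 0 < s \<and> s \<le> 1 \<and> \<alpha> \<in> A"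
  by (auto simp: hedgehog_def)

lemma spine_point_in_hedgehog [simp]:
  "0 \<le> r \<Longrightarrow> r \<le> 1 \<Longrightarrow> \<alpha> \<in> A \<Longrightarrow> spine_point \<alpha> r \<in> hedgehog A"
  by (auto simp: spine_point_def)

lemma coord_spine_point [simp]: "coord \<alpha> (spine_point \<beta> r) = (if \<beta> = \<alpha> then r else - r)"
  by (auto simp: spine_point_def)

lemma abs_coord: "p \<in> hedgehog A \<Longrightarrow> \<bar>coord \<alpha> p\<bar> = height p"
  by (cases p) auto

lemma height_bounds: "p \<in> hedgehog A \<Longrightarrow> 0 \<le> height p \<and> height p \<le> 1"
  by (cases p) auto

lemma coord_le_height: "p \<in> hedgehog A \<Longrightarrow> coord \<alpha> p \<le> height p"
  by (cases p) auto

lemma coord_le_1: "p \<in> hedgehog A \<Longrightarrow> coord \<alpha> p \<le> 1"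
  by (cases p) auto

lemma coord_eq_iff:
  assumes "p \<in> hedgehog A" "0 \<le> coord \<alpha> p"
  shows "p = spine_point \<alpha> (coord \<alpha> p)"
  using assms by (cases p) (auto simp: spine_point_def split: if_splits)

lemma coord_pos_unique:
  "p \<in> hedgehog A \<Longrightarrow> 0 < coord \<alpha> p \<Longrightarrow> 0 < coord \<beta> p \<Longrightarrow> \<alpha> = \<beta>"
  by (cases p) (auto split: if_splits)

lemma coord_Lipschitz:
  assumes "p \<in> hedgehog A" "q \<in> hedgehog A"
  shows "\<bar>coord \<alpha> p - coord \<alpha> q\<bar> \<le> hedgehog_dist p q"
  using assms by (cases p; cases q) auto

text \<open>Folding preserves distances to the spine that is left unfolded: from any other spine the
  way leads through the origin, and the minus sign turns the sum of the heights into a difference of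
  coordinates.\<close>

lemma hedgehog_dist_spine_point:
  assumes "p \<in> hedgehog A" "0 \<le> r"
  shows "hedgehog_dist p (spine_point \<alpha> r) = \<bar>r - coord \<alpha> p\<bar>"
  using assms by (cases p) (auto simp: spine_point_def)

lemma continuous_map_coord: "continuous_map (hedgehog_space A) euclideanreal (coord \<alpha>)"
proof -
  have "continuous_map (hedgehog_space A) Met_TC.mtopology (coord \<alpha>)"
    unfolding hedgehog_space_def
    unfolding Metric_space.metric_continuous_map[OF Metric_space_hedgehog Met_TC.Metric_space_axioms]
  proof (intro conjI ballI allI impI)
    show "\<exists>\<delta>>0. \<forall>q. q \<in> hedgehog A \<and> hedgehog_dist p q < \<delta> \<longrightarrow> dist (coord \<alpha> p) (coord \<alpha> q) < \<epsilon>"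
      if "p \<in> hedgehog A" "0 < \<epsilon>" for p \<epsilon>
      using coord_Lipschitz[OF that(1)] that(2)
      by (intro exI[of _ \<epsilon>]) (auto simp: dist_real_def intro: order.strict_trans1)
  qed simp
  then show ?thesis
    by simp
qed

lemma openin_coord_greater: "openin (hedgehog_space A) {p \<in> hedgehog A. r < coord \<alpha> p}"
  using continuous_map_coord[of A \<alpha>]
  unfolding continuous_map_upper_lower_semicontinuous_lt topspace_hedgehog_space by blast

lemma openin_coord_less: "openin (hedgehog_space A) {p \<in> hedgehog A. coord \<alpha> p < r}"
  using continuous_map_coord[of A \<alpha>]
  unfolding continuous_map_upper_lower_semicontinuous_lt topspace_hedgehog_space by blast

lemma closedin_coord_ge: "closedin (hedgehog_space A) {p \<in> hedgehog A. r \<le> coord \<alpha> p}"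
proof -
  have "hedgehog A - {p \<in> hedgehog A. r \<le> coord \<alpha> p} = {p \<in> hedgehog A. coord \<alpha> p < r}"
    by auto
  then show ?thesis
    using openin_coord_less by (auto simp: closedin_def topspace_hedgehog_space)
qed

lemma openin_height_less: "openin (hedgehog_space A) {p \<in> hedgehog A. height p < r}"
proof -
  interpret Metric_space "hedgehog A" hedgehog_dist
    by (rule Metric_space_hedgehog)
  have "{p \<in> hedgehog A. height p < r} = mball Origin r"
    by auto
  then show ?thesis
    unfolding hedgehog_space_def by simp
qed

lemma connectedin_hedgehog_IVT:
  assumes C: "connectedin (hedgehog_space A) C" and p: "p \<in> C" "coord \<alpha> p \<le> r"
    and q: "q \<in> C" "r \<le> coord \<alpha> q" and r: "0 \<le> r"
  shows "spine_point \<alpha> r \<in> C"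
proof -
  have "connected (coord \<alpha> ` C)"
    using connectedin_continuous_map_image[OF continuous_map_coord C] by simp
  then have "r \<in> coord \<alpha> ` C"
    using p q connectedD_interval[of "coord \<alpha> ` C" "coord \<alpha> p" "coord \<alpha> q" r] by blast
  then obtain z where z: "z \<in> C" "coord \<alpha> z = r"
    by blast
  moreover have "z \<in> hedgehog A"
    using connectedin_subset_topspace[OF C] z(1) by (auto simp: topspace_hedgehog_space)
  ultimately show ?thesis
    using coord_eq_iff[of z A \<alpha>] r by simp
qed

lemma continuous_map_spine_point:
  assumes "\<alpha> \<in> A"
  shows "continuous_map (top_of_set {0..1}) (hedgehog_space A) (spine_point \<alpha>)"
proof -
  interpret Metric_space "hedgehog A" hedgehog_dist
    by (rule Metric_space_hedgehog)
  have d: "hedgehog_dist (spine_point \<alpha> s) (spine_point \<alpha> t) = \<bar>s - t\<bar>" if "0 \<le> s" "0 \<le> t" for s t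
    using that by (auto simp: spine_point_def)
  show ?thesis
    unfolding hedgehog_space_def continuous_map_to_metric
  proof (intro ballI allI impI)
    fix s and \<epsilon> :: real assume s: "s \<in> topspace (top_of_set {0..1::real})" and \<epsilon>: "0 < \<epsilon>"
    have "openin (top_of_set {0..1}) ({0..1} \<inter> ball s \<epsilon>)"
      by (simp add: openin_open_Int)
    moreover have "spine_point \<alpha> t \<in> mball (spine_point \<alpha> s) \<epsilon>" if "t \<in> {0..1} \<inter> ball s \<epsilon>" for t
      using that s assms d[of s t] by (auto simp: dist_real_def)
    ultimately show "\<exists>U. openin (top_of_set {0..1}) U \<and> s \<in> U \<and>
        (\<forall>t\<in>U. spine_point \<alpha> t \<in> mball (spine_point \<alpha> s) \<epsilon>)"
      using s \<epsilon> by (intro exI[of _ "{0..1} \<inter> ball s \<epsilon>"]) auto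
  qed
qed

lemma segment_compact_connected:
  assumes "\<alpha> \<in> A" "t \<le> 1"
  shows "compactin (hedgehog_space A) (spine_point \<alpha> ` {0..t})"
    "connectedin (hedgehog_space A) (spine_point \<alpha> ` {0..t})"
proof -
  have "{0..t} \<subseteq> {0..1}"
    using assms by auto
  then show "compactin (hedgehog_space A) (spine_point \<alpha> ` {0..t})"
    by (intro image_compactin[OF _ continuous_map_spine_point[OF assms(1)]])
      (simp add: compactin_subtopology)
  show "connectedin (hedgehog_space A) (spine_point \<alpha> ` {0..t})"
    using \<open>{0..t} \<subseteq> {0..1}\<close>
    by (intro connectedin_continuous_map_image[OF continuous_map_spine_point[OF assms(1)]])
      (simp add: connectedin_subtopology)
qed

text \<open>For nonnegative \<open>c\<close> the condition at \<alpha> restricts only the spine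
  \<alpha>, since all other points have coordinate at most 0 there. As an intersection of coordinate
  bounds the star is visibly closed.\<close>

definition star :: "'b set \<Rightarrow> ('b \<Rightarrow> real) \<Rightarrow> 'b hedgehog_point set" where
  "star A c = {p \<in> hedgehog A. \<forall>\<alpha>\<in>A. coord \<alpha> p \<le> c \<alpha>}"

lemma star_eq:
  assumes "A \<noteq> {}" "\<And>\<alpha>. \<alpha> \<in> A \<Longrightarrow> 0 \<le> c \<alpha>" "\<And>\<alpha>. \<alpha> \<in> A \<Longrightarrow> c \<alpha> \<le> 1"
  shows "star A c = (\<Union>\<alpha>\<in>A. spine_point \<alpha> ` {0..c \<alpha>})"
proof
  show "star A c \<subseteq> (\<Union>\<alpha>\<in>A. spine_point \<alpha> ` {0..c \<alpha>})"
  proof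
    fix p assume p: "p \<in> star A c"
    show "p \<in> (\<Union>\<alpha>\<in>A. spine_point \<alpha> ` {0..c \<alpha>})"
    proof (cases p)
      case Origin
      obtain \<alpha> where "\<alpha> \<in> A"
        using assms(1) by blast
      then show ?thesis
        using assms(2) Origin by (intro UN_I[of \<alpha>] image_eqI[of _ _ 0]) (auto simp: spine_point_def)
    next
      case (Spine s \<beta>)
      then have "\<beta> \<in> A" "0 < s" "s \<le> c \<beta>"
        using p by (auto simp: star_def)
      then show ?thesis
        using Spine by (intro UN_I[of \<beta>] image_eqI[of _ _ s]) (auto simp: spine_point_def)
    qed
  qed
  show "(\<Union>\<alpha>\<in>A. spine_point \<alpha> ` {0..c \<alpha>}) \<subseteq> star A c"
  proof clarify
    fix \<alpha> r assume \<alpha>: "\<alpha> \<in> A" and r: "r \<in> {0..c \<alpha>}"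
    have "coord \<beta> (spine_point \<alpha> r) \<le> c \<beta>" if "\<beta> \<in> A" for \<beta>
      using assms(2)[OF that] r by auto
    then show "spine_point \<alpha> r \<in> star A c"
      using assms(3)[OF \<alpha>] r \<alpha> by (auto simp: star_def)
  qed
qed

lemma connectedin_star:
  assumes "A \<noteq> {}" "\<And>\<alpha>. \<alpha> \<in> A \<Longrightarrow> 0 \<le> c \<alpha>" "\<And>\<alpha>. \<alpha> \<in> A \<Longrightarrow> c \<alpha> \<le> 1"
  shows "connectedin (hedgehog_space A) (star A c)"
proof -
  have eq: "star A c = (\<Union>\<alpha>\<in>A. spine_point \<alpha> ` {0..c \<alpha>})"
    by (rule star_eq) (use assms in auto)
  have "Origin \<in> spine_point \<alpha> ` {0..c \<alpha>}" if "\<alpha> \<in> A" for \<alpha>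
    using assms(2)[OF that] by (intro image_eqI[of _ _ 0]) (auto simp: spine_point_def)
  then have "\<Inter> ((\<lambda>\<alpha>. spine_point \<alpha> ` {0..c \<alpha>}) ` A) \<noteq> {}"
    by blast
  then show ?thesis
    unfolding eq
    by (intro connectedin_Union) (auto intro: segment_compact_connected(2) assms(3))
qed

text \<open>An open set containing the origin contains a ball around it, and by \<open>fin\<close>
  only finitely many spines of the star stick out of that ball; their segments are compact.\<close>

lemma compactin_star:
  assumes "A \<noteq> {}" "\<And>\<alpha>. \<alpha> \<in> A \<Longrightarrow> 0 \<le> c \<alpha>" "\<And>\<alpha>. \<alpha> \<in> A \<Longrightarrow> c \<alpha> \<le> 1"
    and fin: "\<And>\<epsilon>. 0 < \<epsilon> \<Longrightarrow> finite {\<alpha> \<in> A. \<epsilon> \<le> c \<alpha>}"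
  shows "compactin (hedgehog_space A) (star A c)"
  unfolding compactin_def
proof (intro conjI allI impI)
  interpret Metric_space "hedgehog A" hedgehog_dist
    by (rule Metric_space_hedgehog)
  have eq: "star A c = (\<Union>\<alpha>\<in>A. spine_point \<alpha> ` {0..c \<alpha>})"
    by (rule star_eq) (use assms in auto)
  show "star A c \<subseteq> topspace (hedgehog_space A)"
    by (auto simp: star_def topspace_hedgehog_space)
  fix \<U> assume \<U>: "Ball \<U> (openin (hedgehog_space A)) \<and> star A c \<subseteq> \<Union>\<U>"
  have "Origin \<in> star A c"
    using assms(2) by (auto simp: star_def)
  then obtain V where V: "V \<in> \<U>" "Origin \<in> V"
    using \<U> by blast
  then have "openin mtopology V"
    using \<U> by (simp add: hedgehog_space_def)
  then obtain r where r: "r > 0" "mball Origin r \<subseteq> V"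
    using V(2) unfolding openin_mtopology by blast
  define K where "K = (\<Union>\<alpha>\<in>{\<alpha>\<in>A. r \<le> c \<alpha>}. spine_point \<alpha> ` {0..c \<alpha>})"
  have "compactin (hedgehog_space A) K"
    unfolding K_def using fin[OF r(1)]
    by (intro compactin_Union) (auto intro: segment_compact_connected(1) assms(3))
  moreover have "K \<subseteq> \<Union>\<U>"
    using \<U> unfolding eq K_def by blast
  ultimately obtain \<F> where \<F>: "finite \<F>" "\<F> \<subseteq> \<U>" "K \<subseteq> \<Union>\<F>"
    using \<U> compactinD[of "hedgehog_space A" K \<U>] by auto
  have "star A c \<subseteq> \<Union>(insert V \<F>)"
  proof
    fix p assume "p \<in> star A c"
    then obtain \<alpha> s where \<alpha>: "\<alpha> \<in> A" "p = spine_point \<alpha> s" "0 \<le> s" "s \<le> c \<alpha>"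
      unfolding eq by auto
    show "p \<in> \<Union>(insert V \<F>)"
    proof (cases "r \<le> c \<alpha>")
      case True
      then have "p \<in> K"
        using \<alpha> by (auto simp: K_def)
      then show ?thesis
        using \<F> by blast
    next
      case False
      have "p \<in> hedgehog A"
        using \<open>p \<in> star A c\<close> by (simp add: star_def)
      moreover have "height p < r"
        using False \<alpha> r by (auto simp: spine_point_def)
      ultimately have "p \<in> mball Origin r"
        by simp
      then show ?thesis
        using r by blast
    qed
  qed
  then show "\<exists>\<F>. finite \<F> \<and> \<F> \<subseteq> \<U> \<and> star A c \<subseteq> \<Union>\<F>"
    using \<F> V by (intro exI[of _ "insert V \<F>"]) auto
qed

text \<open>Truncating a point at the extent of the other star moves it only along its own spine, by
  at most the difference of the two extents. Closeness uniform in \<alpha> therefore gives closeness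
  of the stars in the Hausdorff sense.\<close>

lemma star_near:
  assumes c: "\<And>\<alpha>. \<alpha> \<in> A \<Longrightarrow> 0 \<le> c \<alpha>" "\<And>\<alpha>. \<alpha> \<in> A \<Longrightarrow> 0 \<le> c' \<alpha>"
    and near: "\<And>\<alpha>. \<alpha> \<in> A \<Longrightarrow> \<bar>c \<alpha> - c' \<alpha>\<bar> < \<epsilon>" and \<epsilon>: "0 < \<epsilon>" and p: "p \<in> star A c"
  shows "\<exists>q \<in> star A c'. hedgehog_dist p q < \<epsilon>"
proof (cases p)
  case Origin
  then show ?thesis
    using c(2) \<epsilon> by (intro bexI[of _ Origin]) (auto simp: star_def)
next
  case (Spine s \<alpha>)
  then have \<alpha>: "\<alpha> \<in> A" "0 < s" "s \<le> 1" "s \<le> c \<alpha>"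
    using p by (auto simp: star_def)
  define t where "t = min s (c' \<alpha>)"
  have t: "0 \<le> t" "t \<le> 1" "t \<le> c' \<alpha>" "\<bar>s - t\<bar> < \<epsilon>"
    using \<alpha> c(2)[OF \<alpha>(1)] near[OF \<alpha>(1)] \<epsilon> by (auto simp: t_def)
  have "coord \<beta> (spine_point \<alpha> t) \<le> c' \<beta>" if "\<beta> \<in> A" for \<beta>
    using c(2)[OF that] t by auto
  moreover have "hedgehog_dist p (spine_point \<alpha> t) < \<epsilon>"
    using Spine \<alpha> t by (auto simp: spine_point_def)
  ultimately show ?thesis
    using t \<alpha> by (intro bexI[of _ "spine_point \<alpha> t"]) (auto simp: star_def)
qed

text \<open>Pushes the origin to height \<open>a\<close> on the spine \<open>\<alpha>\<close>: every other spine is pulled through the origin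
  by the amount \<open>a\<close>, while the points of the spine \<open>\<alpha>\<close> at height at least \<open>a\<close> are fixed.\<close>

definition push :: "real \<Rightarrow> 'b \<Rightarrow> 'b hedgehog_point \<Rightarrow> 'b hedgehog_point" where
  "push a \<alpha> p = (case p of Origin \<Rightarrow> spine_point \<alpha> a
    | Spine s \<beta> \<Rightarrow> if \<beta> = \<alpha> then Spine (max s a) \<alpha>
        else if a < s then Spine (s - a) \<beta> else spine_point \<alpha> (a - s))"

lemma push_in_hedgehog:
  assumes "0 \<le> a" "a \<le> 1" "\<alpha> \<in> A" "p \<in> hedgehog A"
  shows "push a \<alpha> p \<in> hedgehog A"
  using assms by (cases p) (auto simp: push_def)

text \<open>The spine is irrelevant here, which makes a discontinuous choice of spines harmless
  where the amount of pushing vanishes.\<close>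

lemma push_0: "p \<in> hedgehog A \<Longrightarrow> push 0 \<alpha> p = p"
  by (cases p) (auto simp: push_def spine_point_def)

lemma push_fixed: "p \<in> hedgehog A \<Longrightarrow> 0 \<le> a \<Longrightarrow> a \<le> coord \<alpha> p \<Longrightarrow> push a \<alpha> p = p"
  by (cases p) (auto simp: push_def spine_point_def split: if_splits)

text \<open>On the line folded at \<alpha>, pushing sends a coordinate u to u + a for u \<le> 0 and
  to max u a for u \<ge> 0, a nonexpansive map; two distinct other spines only come closer, as both
  are pulled towards the origin.\<close>

lemma hedgehog_dist_push:
  assumes "0 \<le> a" "p \<in> hedgehog A" "q \<in> hedgehog A"
  shows "hedgehog_dist (push a \<alpha> p) (push a \<alpha> q) \<le> hedgehog_dist p q"
  using assms by (cases p; cases q) (auto simp: push_def spine_point_def max_def)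

lemma hedgehog_dist_push_push:
  assumes "0 \<le> a" "0 \<le> b" "p \<in> hedgehog A"
  shows "hedgehog_dist (push a \<alpha> p) (push b \<alpha> p) \<le> \<bar>a - b\<bar>"
  using assms by (cases p) (auto simp: push_def spine_point_def max_def)

lemma continuous_map_push:
  assumes "0 \<le> a" "a \<le> 1" "\<alpha> \<in> A"
  shows "continuous_map (hedgehog_space A) (hedgehog_space A) (push a \<alpha>)"
  unfolding hedgehog_space_def
  unfolding Metric_space.metric_continuous_map[OF Metric_space_hedgehog Metric_space_hedgehog]
proof (intro conjI ballI allI impI)
  show "push a \<alpha> ` hedgehog A \<subseteq> hedgehog A"
    using push_in_hedgehog[OF assms] by blast
  show "\<exists>\<delta>>0. \<forall>q. q \<in> hedgehog A \<and> hedgehog_dist p q < \<delta> \<longrightarrow> hedgehog_dist (push a \<alpha> p) (push a \<alpha> q) < \<epsilon>"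
    if "p \<in> hedgehog A" "0 < \<epsilon>" for p \<epsilon>
    using hedgehog_dist_push[OF assms(1) that(1)] that(2)
    by (intro exI[of _ \<epsilon>]) (auto intro: order.strict_trans1)
qed

subsection \<open>Semicontinuous set-valued maps into the hedgehog\<close>

lemma finite_openin_neighbourhood:
  assumes "finite S" "x \<in> topspace X"
    and "\<And>i. i \<in> S \<Longrightarrow> \<exists>N. openin X N \<and> x \<in> N \<and> (\<forall>y\<in>N. P i y)"
  shows "\<exists>N. openin X N \<and> x \<in> N \<and> (\<forall>y\<in>N. \<forall>i\<in>S. P i y)"
  using assms(1,3)
proof (induction S rule: finite_induct)
  case empty
  show ?case
    using assms(2) by (intro exI[of _ "topspace X"]) auto
next
  case (insert i S)
  obtain M where M: "openin X M" "x \<in> M" "\<forall>y\<in>M. \<forall>j\<in>S. P j y"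
    using insert by auto
  obtain N where N: "openin X N" "x \<in> N" "\<forall>y\<in>N. P i y"
    using insert.prems[of i] by auto
  show ?case
    using M N by (intro exI[of _ "M \<inter> N"]) auto
qed

lemma locally_finite_family_UN:
  assumes "finite J" "\<And>j. j \<in> J \<Longrightarrow> locally_finite_family X I (E j)"
  shows "locally_finite_family X I (\<lambda>i. \<Union>j\<in>J. E j i)"
  unfolding locally_finite_family_def
proof
  fix x assume x: "x \<in> topspace X"
  have "\<forall>j\<in>J. \<exists>N. openin X N \<and> x \<in> N \<and> finite {i \<in> I. E j i \<inter> N \<noteq> {}}"
    using assms(2) x unfolding locally_finite_family_def by blast
  from bchoice[OF this] obtain N
    where N: "\<forall>j\<in>J. openin X (N j) \<and> x \<in> N j \<and> finite {i \<in> I. E j i \<inter> N j \<noteq> {}}"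
    by (elim exE)
  obtain M where M: "openin X M" "x \<in> M" "\<forall>y\<in>M. \<forall>j\<in>J. y \<in> N j"
    using finite_openin_neighbourhood[OF assms(1) x, of "\<lambda>j y. y \<in> N j"] N by auto
  have "{i \<in> I. (\<Union>j\<in>J. E j i) \<inter> M \<noteq> {}} \<subseteq> (\<Union>j\<in>J. {i \<in> I. E j i \<inter> N j \<noteq> {}})"
    using M(3) by blast
  moreover have "finite (\<Union>j\<in>J. {i \<in> I. E j i \<inter> N j \<noteq> {}})"
    using assms(1) N by auto
  ultimately have "finite {i \<in> I. (\<Union>j\<in>J. E j i) \<inter> M \<noteq> {}}"
    by (rule finite_subset)
  then show "\<exists>N. openin X N \<and> x \<in> N \<and> finite {i \<in> I. (\<Union>j\<in>J. E j i) \<inter> N \<noteq> {}}"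
    using M(1,2) by (intro exI[of _ M] conjI)
qed

text \<open>The compact \<open>\<theta> x\<close> is covered by the ball of radius \<epsilon> at the
  origin and finitely many open spines. By upper semicontinuity nearby values stay inside this open
  set, where a point of height at least \<epsilon> must be on one of these spines.\<close>

lemma usc_compact_hedgehog_locally_finite:
  assumes usc: "usc_map X (hedgehog_space A) \<theta>"
    and comp: "\<And>x. x \<in> topspace X \<Longrightarrow> compactin (hedgehog_space A) (\<theta> x)" and \<epsilon>: "0 < \<epsilon>"
  shows "locally_finite_family X A
    (\<lambda>\<alpha>. {x \<in> topspace X. \<theta> x \<inter> {p \<in> hedgehog A. \<epsilon> \<le> coord \<alpha> p} \<noteq> {}})"
  unfolding locally_finite_family_def
proof
  have sub: "\<theta> x \<subseteq> hedgehog A" if "x \<in> topspace X" for x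
    using compactin_subset_topspace[OF comp[OF that]] by (simp add: topspace_hedgehog_space)
  fix x assume x: "x \<in> topspace X"
  let ?G = "\<lambda>\<alpha>. {p \<in> hedgehog A. 0 < coord \<alpha> p}"
  let ?H = "{p \<in> hedgehog A. height p < \<epsilon>}"
  have cover: "\<theta> x \<subseteq> \<Union>(insert ?H (?G ` A))"
  proof
    fix p assume "p \<in> \<theta> x"
    then have "p \<in> hedgehog A"
      using sub[OF x] by blast
    then show "p \<in> \<Union>(insert ?H (?G ` A))"
      using \<epsilon> by (cases p) auto
  qed
  have opn: "openin (hedgehog_space A) U" if "U \<in> insert ?H (?G ` A)" for U
    using that openin_coord_greater[of A 0] openin_height_less[of A \<epsilon>] by auto
  obtain \<F> where \<F>: "finite \<F>" "\<F> \<subseteq> insert ?H (?G ` A)" "\<theta> x \<subseteq> \<Union>\<F>"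
    using compactinD[OF comp[OF x], of "insert ?H (?G ` A)", OF opn cover] by auto
  have "finite (\<F> - {?H})" "\<F> - {?H} \<subseteq> ?G ` A"
    using \<F> by auto
  from finite_subset_image[OF this] obtain S where S: "S \<subseteq> A" "finite S" "\<F> - {?H} = ?G ` S"
    by auto
  let ?W = "?H \<union> (\<Union>\<alpha>\<in>S. ?G \<alpha>)"
  have "openin (hedgehog_space A) ?W"
    using openin_coord_greater openin_height_less by (intro openin_Un openin_Union) auto
  then have "openin X {y \<in> topspace X. \<theta> y \<subseteq> ?W}"
    using sub by (intro usc_map_openin_subset[OF usc]) (auto simp: topspace_hedgehog_space)
  moreover have "\<theta> x \<subseteq> ?W"
    using \<F>(3) S(3) by blast
  moreover have "{\<alpha> \<in> A. {x \<in> topspace X. \<theta> x \<inter> {p \<in> hedgehog A. \<epsilon> \<le> coord \<alpha> p} \<noteq> {}} \<inter>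
      {y \<in> topspace X. \<theta> y \<subseteq> ?W} \<noteq> {}} \<subseteq> S"
  proof
    fix \<alpha> assume "\<alpha> \<in> {\<alpha> \<in> A. {x \<in> topspace X. \<theta> x \<inter> {p \<in> hedgehog A. \<epsilon> \<le> coord \<alpha> p} \<noteq> {}} \<inter>
      {y \<in> topspace X. \<theta> y \<subseteq> ?W} \<noteq> {}}"
    then obtain y p where p: "p \<in> \<theta> y" "p \<in> hedgehog A" "\<epsilon> \<le> coord \<alpha> p" and y: "\<theta> y \<subseteq> ?W"
      by blast
    have "p \<notin> ?H"
      using coord_le_height[OF p(2), of \<alpha>] p(3) by auto
    then obtain \<beta> where "\<beta> \<in> S" "0 < coord \<beta> p"
      using p(1) y by blast
    then show "\<alpha> \<in> S"
      using coord_pos_unique[OF p(2), of \<alpha> \<beta>] p(3) \<epsilon> by auto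
  qed
  ultimately show "\<exists>N. openin X N \<and> x \<in> N \<and>
      finite {\<alpha> \<in> A. {x \<in> topspace X. \<theta> x \<inter> {p \<in> hedgehog A. \<epsilon> \<le> coord \<alpha> p} \<noteq> {}} \<inter> N \<noteq> {}}"
    using x finite_subset[OF _ S(2)] by (intro exI[of _ "{y \<in> topspace X. \<theta> y \<subseteq> ?W}"]) auto
qed

text \<open>If the point were missing, closedness would keep all coordinates of \<open>C\<close> at
  some distance \<rho> from r. Approximations better than \<rho> would then lie on both sides of r,
  and a connected set cannot jump over it.\<close>

lemma closed_connected_hedgehog_limit:
  assumes C: "closedin (hedgehog_space A) C" "connectedin (hedgehog_space A) C"
    and \<alpha>: "\<alpha> \<in> A" and r: "0 \<le> r" "r \<le> 1"
    and below: "\<And>\<epsilon>. 0 < \<epsilon> \<Longrightarrow> \<exists>p\<in>C. coord \<alpha> p < r + \<epsilon>"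
    and above: "\<And>\<epsilon>. 0 < \<epsilon> \<Longrightarrow> \<exists>q\<in>C. r - \<epsilon> < coord \<alpha> q"
  shows "spine_point \<alpha> r \<in> C"
proof (rule ccontr)
  interpret Metric_space "hedgehog A" hedgehog_dist
    by (rule Metric_space_hedgehog)
  assume not: "spine_point \<alpha> r \<notin> C"
  have sub: "C \<subseteq> hedgehog A"
    using closedin_subset[OF C(1)] by (simp add: topspace_hedgehog_space)
  have "spine_point \<alpha> r \<in> hedgehog A - C"
    using not \<alpha> r by simp
  then obtain \<rho> where \<rho>: "\<rho> > 0" "disjnt C (mball (spine_point \<alpha> r) \<rho>)"
    using C(1) unfolding hedgehog_space_def closedin_metric by blast
  have far: "\<rho> \<le> \<bar>r - coord \<alpha> p\<bar>" if "p \<in> C" for p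
  proof -
    have p: "p \<in> hedgehog A"
      using that sub by blast
    have "p \<notin> mball (spine_point \<alpha> r) \<rho>"
      using \<rho>(2) that by (auto simp: disjnt_iff)
    then have "\<not> hedgehog_dist p (spine_point \<alpha> r) < \<rho>"
      using p \<alpha> r commute[of p "spine_point \<alpha> r"] by simp
    then show ?thesis
      using hedgehog_dist_spine_point[OF p r(1), of \<alpha>] by simp
  qed
  obtain p where p: "p \<in> C" "coord \<alpha> p < r + \<rho>"
    using below[OF \<rho>(1)] by blast
  obtain q where q: "q \<in> C" "r - \<rho> < coord \<alpha> q"
    using above[OF \<rho>(1)] by blast
  have "coord \<alpha> p \<le> r" "r \<le> coord \<alpha> q"
    using far[OF p(1)] far[OF q(1)] p(2) q(2) by linarith+
  then show False
    using connectedin_hedgehog_IVT[OF C(2) p(1) _ q(1) _ r(1)] not by blast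
qed

text \<open>On other spines heights only decrease, and what crosses to \<alpha> arrives at height at
  most \<open>a\<close>, which \<open>c \<alpha>\<close> allows. Hence pushing never leaves \<Phi> x
  when \<Phi> x contains the whole star.\<close>

lemma push_star:
  assumes "0 \<le> a" "a \<le> c \<alpha>" "\<alpha> \<in> A" "\<And>\<beta>. \<beta> \<in> A \<Longrightarrow> 0 \<le> c \<beta>" "c \<alpha> \<le> 1" "p \<in> star A c"
  shows "push a \<alpha> p \<in> star A c"
proof -
  have p: "p \<in> hedgehog A" "\<And>\<beta>. \<beta> \<in> A \<Longrightarrow> coord \<beta> p \<le> c \<beta>"
    using assms(6) by (auto simp: star_def)
  have "coord \<beta> (push a \<alpha> p) \<le> c \<beta>" if "\<beta> \<in> A" for \<beta>
    using p(2)[OF that] assms(1,2) p(1) assms(4)[OF that]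
    by (cases p) (auto simp: push_def)
  then show ?thesis
    using push_in_hedgehog[OF assms(1) _ assms(3) p(1)] assms(2,5) by (simp add: star_def)
qed

section \<open>Insertion without strictness\<close>

locale hedgehog_sandwich =
  fixes X :: "'a topology" and A :: "'b set" and \<Phi> \<theta> :: "'a \<Rightarrow> 'b hedgehog_point set"
  assumes normal: "normal_space X"
    and closed_\<Phi>: "\<And>x. x \<in> topspace X \<Longrightarrow> closedin (hedgehog_space A) (\<Phi> x)"
    and connected_\<Phi>: "\<And>x. x \<in> topspace X \<Longrightarrow> connectedin (hedgehog_space A) (\<Phi> x)"
    and lsc_\<Phi>: "lsc_map X (hedgehog_space A) \<Phi>"
    and compact_\<theta>: "\<And>x. x \<in> topspace X \<Longrightarrow> compactin (hedgehog_space A) (\<theta> x)"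
    and \<theta>_nonempty: "\<And>x. x \<in> topspace X \<Longrightarrow> \<theta> x \<noteq> {}"
    and usc_\<theta>: "usc_map X (hedgehog_space A) \<theta>"
    and \<theta>_subset: "\<And>x. x \<in> topspace X \<Longrightarrow> \<theta> x \<subseteq> \<Phi> x"
begin

lemma \<Phi>_in_hedgehog: "x \<in> topspace X \<Longrightarrow> p \<in> \<Phi> x \<Longrightarrow> p \<in> hedgehog A"
  using closedin_subset[OF closed_\<Phi>] by (auto simp: topspace_hedgehog_space)

lemma \<theta>_in_hedgehog: "x \<in> topspace X \<Longrightarrow> p \<in> \<theta> x \<Longrightarrow> p \<in> hedgehog A"
  using \<Phi>_in_hedgehog \<theta>_subset by blast

lemma openin_\<theta>_subset:
  "openin (hedgehog_space A) U \<Longrightarrow> openin X {x \<in> topspace X. \<theta> x \<subseteq> U}"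
  by (rule usc_map_openin_subset[OF usc_\<theta>]) (auto simp: topspace_hedgehog_space \<theta>_in_hedgehog)

lemma openin_\<Phi>_meets:
  "openin (hedgehog_space A) U \<Longrightarrow> openin X {x \<in> topspace X. \<Phi> x \<inter> U \<noteq> {}}"
  by (rule lsc_map_openin_meets[OF lsc_\<Phi>])

text \<open>The origin separates the spines, so a connected value missing it stays on one of
  them.\<close>

lemma \<Phi>_positive_coord:
  assumes x: "x \<in> topspace X" and "Origin \<notin> \<Phi> x" "p \<in> \<Phi> x" "0 < coord \<alpha> p" "q \<in> \<Phi> x"
  shows "0 < coord \<alpha> q"
proof (rule ccontr)
  assume "\<not> 0 < coord \<alpha> q"
  then have "spine_point \<alpha> 0 \<in> \<Phi> x"
    using connectedin_hedgehog_IVT[OF connected_\<Phi>[OF x], of q \<alpha> 0 p] assms by auto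
  then show False
    using assms(2) by (simp add: spine_point_def)
qed

text \<open>The distance \<open>d\<close> of the origin from \<Phi> x is upper semicontinuous
  because \<Phi> is l.s.c., and the lowest height \<open>t\<close> of \<theta> x on a common spine
  is lower semicontinuous because \<theta> is u.s.c. They compare: either \<Phi> x comes arbitrarily
  near the origin and d x = 0, or it lies on one spine, and then so does \<theta> x, at height at
  least d x.\<close>

lemma lower_function:
  obtains e where "continuous_map X euclideanreal e"
    "\<And>x. x \<in> topspace X \<Longrightarrow> 0 \<le> e x \<and> e x \<le> 1"
    "\<And>x r. x \<in> topspace X \<Longrightarrow> e x < r \<Longrightarrow> \<exists>p\<in>\<Phi> x. height p < r"
    "\<And>x. x \<in> topspace X \<Longrightarrow> 0 < e x \<Longrightarrow> \<exists>\<alpha>\<in>A. \<forall>p\<in>\<theta> x. e x \<le> coord \<alpha> p"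
proof -
  define d where "d x = Inf (height ` \<Phi> x)" for x
  \<comment> \<open>The 0 is the value when no spine contains all of \<theta> x. Strict bounds are
    used because \<open>\<theta> x \<subseteq> {p. r < coord \<alpha> p}\<close> is an open
    condition on x.\<close>
  define T where "T x = insert 0 {r. \<exists>\<alpha>\<in>A. \<theta> x \<subseteq> {p \<in> hedgehog A. r < coord \<alpha> p}}" for x
  define t where "t x = Sup (T x)" for x
  have \<Phi>_ne: "\<Phi> x \<noteq> {}" if "x \<in> topspace X" for x
    using \<theta>_nonempty[OF that] \<theta>_subset[OF that] by blast
  have bdd_d: "bdd_below (height ` \<Phi> x)" if "x \<in> topspace X" for x
    using height_bounds[OF \<Phi>_in_hedgehog[OF that]] by (intro bdd_belowI[of _ 0]) auto
  have T_le: "r \<le> 1" if x: "x \<in> topspace X" and r: "r \<in> T x" for x r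
  proof -
    obtain p where p: "p \<in> \<theta> x"
      using \<theta>_nonempty[OF x] by blast
    consider "r = 0" | \<alpha> where "\<theta> x \<subseteq> {p \<in> hedgehog A. r < coord \<alpha> p}"
      using r unfolding T_def by auto
    then show ?thesis
    proof cases
      case (2 \<alpha>)
      then have "r < coord \<alpha> p"
        using p by blast
      then show ?thesis
        using coord_le_1[OF \<theta>_in_hedgehog[OF x p], of \<alpha>] by simp
    qed simp
  qed
  then have bdd_t: "bdd_above (T x)" if "x \<in> topspace X" for x
    using that by (intro bdd_aboveI[of _ 1]) auto
  have T_ne: "T x \<noteq> {}" for x
    by (simp add: T_def)
  have d_less: "d x < r \<longleftrightarrow> (\<exists>p\<in>\<Phi> x. height p < r)" if "x \<in> topspace X" for x r
    unfolding d_def using cInf_less_iff[OF _ bdd_d[OF that], of r] \<Phi>_ne[OF that] by simp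
  have t_greater: "r < t x \<longleftrightarrow> (\<exists>s\<in>T x. r < s)" if "x \<in> topspace X" for x r
    unfolding t_def by (rule less_cSup_iff[OF T_ne bdd_t[OF that]])
  have d_nonneg: "0 \<le> d x" if x: "x \<in> topspace X" for x
    unfolding d_def using \<Phi>_ne[OF x] height_bounds[OF \<Phi>_in_hedgehog[OF x]]
    by (intro cInf_greatest) auto
  have t0: "0 \<le> t x" if x: "x \<in> topspace X" for x
    unfolding t_def by (rule cSup_upper[OF _ bdd_t[OF x]]) (simp add: T_def)
  have t1: "t x \<le> 1" if x: "x \<in> topspace X" for x
    unfolding t_def by (rule cSup_least[OF T_ne T_le[OF x]])
  have usc_d: "openin X {x \<in> topspace X. d x < r}" for r
  proof -
    have "{x \<in> topspace X. d x < r} = {x \<in> topspace X. \<Phi> x \<inter> {p \<in> hedgehog A. height p < r} \<noteq> {}}"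
      using d_less \<Phi>_in_hedgehog by blast
    then show ?thesis
      using openin_\<Phi>_meets[OF openin_height_less] by simp
  qed
  have lsc_t: "openin X {x \<in> topspace X. r < t x}" for r
  proof (cases "r < 0")
    case True
    then have "{x \<in> topspace X. r < t x} = topspace X"
      using t0 by force
    then show ?thesis
      by simp
  next
    case False
    have "{x \<in> topspace X. r < t x} =
      (\<Union>s\<in>{r<..}. \<Union>\<alpha>\<in>A. {x \<in> topspace X. \<theta> x \<subseteq> {p \<in> hedgehog A. s < coord \<alpha> p}})"
      using False t_greater unfolding T_def by fastforce
    moreover have "openin X \<dots>"
      using openin_\<theta>_subset[OF openin_coord_greater] by (intro openin_Union) auto
    ultimately show ?thesis
      by simp
  qed
  have d_le_t: "d x \<le> t x" if x: "x \<in> topspace X" for x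
  proof (rule dense_le)
    fix r assume r: "r < d x"
    show "r \<le> t x"
    proof (cases "r < 0")
      case True
      then show ?thesis
        using t0[OF x] by simp
    next
      case False
      have high: "r < height q" if "q \<in> \<Phi> x" for q
      proof -
        have "d x \<le> height q"
          unfolding d_def using that by (intro cInf_lower bdd_d[OF x]) auto
        then show ?thesis
          using r by simp
      qed
      then have no: "Origin \<notin> \<Phi> x"
        using False by force
      obtain p where p: "p \<in> \<theta> x"
        using \<theta>_nonempty[OF x] by blast
      obtain s \<alpha> where s: "p = Spine s \<alpha>" "0 < s" "\<alpha> \<in> A"
        using \<theta>_in_hedgehog[OF x p] no \<theta>_subset[OF x] p by (cases p) auto
      have "q \<in> hedgehog A \<and> r < coord \<alpha> q" if q: "q \<in> \<theta> x" for q
      proof -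
        have "0 < coord \<alpha> q"
          using \<Phi>_positive_coord[OF x no, of p \<alpha> q] p q s \<theta>_subset[OF x] by auto
        then have "coord \<alpha> q = height q"
          using abs_coord[OF \<theta>_in_hedgehog[OF x q], of \<alpha>] by simp
        then show ?thesis
          using high[of q] q \<theta>_subset[OF x] \<theta>_in_hedgehog[OF x q] by auto
      qed
      then have "r \<in> T x"
        using s(3) unfolding T_def by blast
      then show ?thesis
        unfolding t_def by (rule cSup_upper[OF _ bdd_t[OF x]])
    qed
  qed
  have "\<exists>e. continuous_map X euclideanreal e \<and> (\<forall>x \<in> topspace X. d x \<le> e x \<and> e x \<le> t x)"
  proof (rule Katetov_Tong_insertion[OF normal usc_d lsc_t d_le_t])
    show "d x \<le> 1" if "x \<in> topspace X" for x
      using d_le_t[OF that] t1[OF that] by simp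
    show "- 1 \<le> t x" if "x \<in> topspace X" for x
      using t0[OF that] by simp
  qed
  then obtain e where e: "continuous_map X euclideanreal e"
    "\<And>x. x \<in> topspace X \<Longrightarrow> d x \<le> e x \<and> e x \<le> t x"
    by auto
  show thesis
  proof
    show "continuous_map X euclideanreal e"
      by (rule e(1))
    fix x assume x: "x \<in> topspace X"
    show "0 \<le> e x \<and> e x \<le> 1"
      using e(2)[OF x] d_nonneg[OF x] t1[OF x] by simp
    show "\<exists>p\<in>\<Phi> x. height p < r" if "e x < r" for r
      using d_less[OF x, of r] e(2)[OF x] that by simp
    show "\<exists>\<alpha>\<in>A. \<forall>p\<in>\<theta> x. e x \<le> coord \<alpha> p" if pos: "0 < e x"
    proof -
      have ex: "\<exists>s>r. \<exists>\<alpha>\<in>A. \<theta> x \<subseteq> {p \<in> hedgehog A. s < coord \<alpha> p}" if "0 \<le> r" "r < e x" for r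
      proof -
        have "\<exists>s\<in>T x. r < s"
          using t_greater[OF x, of r] e(2)[OF x] that by simp
        then show ?thesis
          using that(1) unfolding T_def by auto
      qed
      obtain s \<alpha> where s: "0 < s" "\<alpha> \<in> A" "\<theta> x \<subseteq> {p \<in> hedgehog A. s < coord \<alpha> p}"
        using ex[OF order_refl pos] by blast
      \<comment> \<open>The supremum t x might be approached along varying spines \<beta>, but a
        single point p with positive coordinate forces them all to equal \<alpha>.\<close>
      have "e x \<le> coord \<alpha> p" if p: "p \<in> \<theta> x" for p
      proof (rule dense_ge)
        fix r assume r: "coord \<alpha> p < r"
        show "e x \<le> r"
        proof (rule ccontr)
          assume "\<not> e x \<le> r"
          moreover have "0 < coord \<alpha> p"
            using s(1,3) p by force
          ultimately obtain u \<beta> where u: "r < u" "\<beta> \<in> A" "\<theta> x \<subseteq> {p \<in> hedgehog A. u < coord \<beta> p}"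
            using ex[of r] r by auto
          have "u < coord \<beta> p"
            using u(3) p by blast
          moreover have "\<beta> = \<alpha>"
            using coord_pos_unique[OF \<theta>_in_hedgehog[OF x p], of \<beta> \<alpha>] \<open>0 < coord \<alpha> p\<close> r u(1) calculation
            by simp
          ultimately show False
            using r u(1) by simp
        qed
      qed
      then show ?thesis
        using s(2) by blast
    qed
  qed
qed

end

lemma dyadic_bracket:
  fixes s :: real
  assumes "0 < s" "s \<le> 1"
  obtains n where "(1/2) ^ Suc n \<le> s" "s \<le> (1/2) ^ n"
proof -
  define P where "P n \<longleftrightarrow> (1/2::real) ^ Suc n \<le> s" for n
  obtain k where k: "(1/2::real) ^ k < s"
    using real_arch_pow_inv[OF assms(1), of "1/2"] by auto
  have "(1/2::real) ^ Suc k \<le> (1/2) ^ k"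
    by simp
  with k have "P k"
    unfolding P_def by linarith
  then have least: "P (LEAST n. P n)"
    by (rule LeastI)
  have "s \<le> (1/2) ^ (LEAST n. P n)"
  proof (cases "LEAST n. P n")
    case 0
    then show ?thesis
      using assms(2) by simp
  next
    case (Suc m)
    then have "\<not> P m"
      by (intro not_less_Least) simp
    then have "s \<le> (1/2) ^ Suc m"
      by (simp only: P_def not_le less_imp_le)
    then show ?thesis
      by (simp only: Suc)
  qed
  with least show thesis
    using that unfolding P_def by blast
qed

text \<open>Near x all but finitely many \<open>c i\<close> take values in [0, \<epsilon>), at x as
  well as at y, so they differ by less than \<epsilon> without any appeal to continuity; the
  remaining ones are finitely many continuity conditions.\<close>

lemma continuous_family_uniform:
  fixes c :: "'i \<Rightarrow> 'a \<Rightarrow> real"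
  assumes c: "\<And>i. i \<in> I \<Longrightarrow> continuous_map X euclideanreal (c i)"
    and nonneg: "\<And>i x. i \<in> I \<Longrightarrow> x \<in> topspace X \<Longrightarrow> 0 \<le> c i x"
    and fin: "\<And>\<epsilon>. 0 < \<epsilon> \<Longrightarrow> locally_finite_family X I (\<lambda>i. {x \<in> topspace X. \<epsilon> \<le> c i x})"
    and x: "x \<in> topspace X" and \<epsilon>: "0 < \<epsilon>"
  shows "\<exists>N. openin X N \<and> x \<in> N \<and> (\<forall>y\<in>N. \<forall>i\<in>I. \<bar>c i x - c i y\<bar> < \<epsilon>)"
proof -
  obtain M where M: "openin X M" "x \<in> M"
      "finite {i \<in> I. {x \<in> topspace X. \<epsilon> \<le> c i x} \<inter> M \<noteq> {}}"
    by (rule locally_finite_familyD[OF fin[OF \<epsilon>] x])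
  let ?S = "{i \<in> I. {x \<in> topspace X. \<epsilon> \<le> c i x} \<inter> M \<noteq> {}}"
  have "\<exists>N. openin X N \<and> x \<in> N \<and> (\<forall>y\<in>N. \<bar>c i x - c i y\<bar> < \<epsilon>)" if i: "i \<in> ?S" for i
  proof (intro exI conjI)
    let ?N = "{y \<in> topspace X. c i x - \<epsilon> < c i y} \<inter> {y \<in> topspace X. c i y < c i x + \<epsilon>}"
    show "openin X ?N"
      using c i unfolding continuous_map_upper_lower_semicontinuous_lt by (intro openin_Int) auto
    show "x \<in> ?N"
      using x \<epsilon> by auto
    show "\<forall>y\<in>?N. \<bar>c i x - c i y\<bar> < \<epsilon>"
      by auto
  qed
  then obtain N where N: "openin X N" "x \<in> N" "\<forall>y\<in>N. \<forall>i\<in>?S. \<bar>c i x - c i y\<bar> < \<epsilon>"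
    using finite_openin_neighbourhood[OF M(3) x, of "\<lambda>i y. \<bar>c i x - c i y\<bar> < \<epsilon>"] by auto
  have "\<bar>c i x - c i y\<bar> < \<epsilon>" if y: "y \<in> M \<inter> N" and i: "i \<in> I" for i y
  proof (cases "i \<in> ?S")
    case True
    then show ?thesis
      using N(3) y by blast
  next
    case False
    have "y \<in> topspace X"
      using y openin_subset[OF M(1)] by blast
    then have "c i y < \<epsilon>" "c i x < \<epsilon>" "0 \<le> c i y" "0 \<le> c i x"
      using False i x y M(2) nonneg by force+
    then show ?thesis
      by linarith
  qed
  then show ?thesis
    using M N by (intro exI[of _ "M \<inter> N"]) auto
qed

context hedgehog_sandwich
begin

text \<open>The lower semicontinuous bound \<open>B \<alpha>\<close> is the extent of \<open>\<Phi>\<close> along the spine \<open>\<alpha>\<close>, cut down by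
  \<open>(1/2) ^ n\<close> outside the locally finite expansions of the sets where \<open>\<theta>\<close> is higher than
  \<open>(1/2) ^ Suc n\<close>; the cut makes the inserted functions vanish uniformly at infinity in \<open>\<alpha>\<close>.\<close>

lemma upper_functions:
  assumes \<tau>: "card_paracompact_space \<tau> X" "Cinfinite \<tau>" "|A| \<le>o \<tau>"
  obtains c where "\<And>\<alpha>. \<alpha> \<in> A \<Longrightarrow> continuous_map X euclideanreal (c \<alpha>)"
    "\<And>\<alpha> x. \<alpha> \<in> A \<Longrightarrow> x \<in> topspace X \<Longrightarrow> 0 \<le> c \<alpha> x \<and> c \<alpha> x \<le> 1"
    "\<And>\<alpha> x p. \<alpha> \<in> A \<Longrightarrow> x \<in> topspace X \<Longrightarrow> p \<in> \<theta> x \<Longrightarrow> coord \<alpha> p \<le> c \<alpha> x"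
    "\<And>\<alpha> x r. \<alpha> \<in> A \<Longrightarrow> x \<in> topspace X \<Longrightarrow> 0 \<le> r \<Longrightarrow> r < c \<alpha> x \<Longrightarrow> \<exists>p\<in>\<Phi> x. r < coord \<alpha> p"
    "\<And>\<epsilon>. 0 < \<epsilon> \<Longrightarrow> locally_finite_family X A (\<lambda>\<alpha>. {x \<in> topspace X. \<epsilon> \<le> c \<alpha> x})"
proof -
  define E where "E n \<alpha> =
    {x \<in> topspace X. \<theta> x \<inter> {p \<in> hedgehog A. (1/2) ^ Suc n \<le> coord \<alpha> p} \<noteq> {}}" for n :: nat and \<alpha>
  have "\<exists>U. (\<forall>\<alpha>\<in>A. openin X (U \<alpha>) \<and> E n \<alpha> \<subseteq> U \<alpha>) \<and> locally_finite_family X A U" for n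
  proof -
    have "closedin X (E n \<alpha>)" for \<alpha>
      unfolding E_def by (rule usc_\<theta>[unfolded usc_map_def, rule_format, OF closedin_coord_ge])
    moreover have "locally_finite_family X A (E n)"
      unfolding E_def
      by (rule usc_compact_hedgehog_locally_finite[OF usc_\<theta> compact_\<theta>]) auto
    ultimately show ?thesis
      by (rule normal_card_paracompact_open_expansion[OF normal \<tau>])
  qed
  then have "\<forall>n. \<exists>U. (\<forall>\<alpha>\<in>A. openin X (U \<alpha>) \<and> E n \<alpha> \<subseteq> U \<alpha>) \<and> locally_finite_family X A U"
    by blast
  from choice[OF this] obtain U where
    U: "\<And>n \<alpha>. \<alpha> \<in> A \<Longrightarrow> openin X (U n \<alpha>)" "\<And>n \<alpha>. \<alpha> \<in> A \<Longrightarrow> E n \<alpha> \<subseteq> U n \<alpha>"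
      "\<And>n. locally_finite_family X A (U n)"
    by auto
  \<comment> \<open>The 0 keeps the set nonempty where no \<open>U n \<alpha>\<close> contains x,
    and its supremum nonnegative where \<Phi> x does not reach the spine \<alpha>.\<close>
  define S where "S \<alpha> x = insert 0 {min (coord \<alpha> p) ((1/2) ^ n) | p n. p \<in> \<Phi> x \<and> x \<in> U n \<alpha>}" for \<alpha> x
  define B where "B \<alpha> x = Sup (S \<alpha> x)" for \<alpha> x
  define T where "T \<alpha> x = Sup (insert 0 (coord \<alpha> ` \<theta> x))" for \<alpha> x
  have S_le: "s \<le> 1" if x: "x \<in> topspace X" and s: "s \<in> S \<alpha> x" for \<alpha> x s
    using s coord_le_1[OF \<Phi>_in_hedgehog[OF x], of _ \<alpha>] unfolding S_def by fastforce
  have bdd_B: "bdd_above (S \<alpha> x)" if "x \<in> topspace X" for \<alpha> x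
    using S_le[OF that] by (intro bdd_aboveI[of _ 1])
  have B_greater: "r < B \<alpha> x \<longleftrightarrow> r < 0 \<or> (\<exists>n. \<exists>p\<in>\<Phi> x. r < coord \<alpha> p \<and> r < (1/2) ^ n \<and> x \<in> U n \<alpha>)"
    if x: "x \<in> topspace X" for \<alpha> x r
  proof -
    have "r < B \<alpha> x \<longleftrightarrow> (\<exists>s\<in>S \<alpha> x. r < s)"
      unfolding B_def by (rule less_cSup_iff[OF _ bdd_B[OF x]]) (simp add: S_def)
    also have "\<dots> \<longleftrightarrow> r < 0 \<or> (\<exists>n. \<exists>p\<in>\<Phi> x. r < coord \<alpha> p \<and> r < (1/2) ^ n \<and> x \<in> U n \<alpha>)"
    proof
      assume "\<exists>s\<in>S \<alpha> x. r < s"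
      then show "r < 0 \<or> (\<exists>n. \<exists>p\<in>\<Phi> x. r < coord \<alpha> p \<and> r < (1/2) ^ n \<and> x \<in> U n \<alpha>)"
        unfolding S_def by auto
    next
      assume "r < 0 \<or> (\<exists>n. \<exists>p\<in>\<Phi> x. r < coord \<alpha> p \<and> r < (1/2) ^ n \<and> x \<in> U n \<alpha>)"
      then show "\<exists>s\<in>S \<alpha> x. r < s"
      proof
        assume "\<exists>n. \<exists>p\<in>\<Phi> x. r < coord \<alpha> p \<and> r < (1/2) ^ n \<and> x \<in> U n \<alpha>"
        then obtain n p where "p \<in> \<Phi> x" "r < coord \<alpha> p" "r < (1/2) ^ n" "x \<in> U n \<alpha>"
          by blast
        then show ?thesis
          unfolding S_def by (intro bexI[of _ "min (coord \<alpha> p) ((1/2) ^ n)"]) auto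
      qed (simp add: S_def)
    qed
    finally show ?thesis .
  qed
  have B0: "0 \<le> B \<alpha> x" if x: "x \<in> topspace X" for \<alpha> x
    unfolding B_def by (rule cSup_upper[OF _ bdd_B[OF x]]) (simp add: S_def)
  have B1: "B \<alpha> x \<le> 1" if x: "x \<in> topspace X" for \<alpha> x
    unfolding B_def by (rule cSup_least[OF _ S_le[OF x]]) (auto simp: S_def)
  have compact_coord: "compact (insert 0 (coord \<alpha> ` \<theta> x))" if x: "x \<in> topspace X" for \<alpha> x
  proof (rule compact_insert)
    show "compact (coord \<alpha> ` \<theta> x)"
      using image_compactin[OF compact_\<theta>[OF x] continuous_map_coord, of \<alpha>] by simp
  qed
  have T_upper: "s \<le> T \<alpha> x" if "x \<in> topspace X" "s \<in> insert 0 (coord \<alpha> ` \<theta> x)" for \<alpha> x s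
    unfolding T_def
    by (rule cSup_upper[OF that(2)])
      (rule bounded_imp_bdd_above[OF compact_imp_bounded[OF compact_coord[OF that(1)]]])
  \<comment> \<open>With the supremum attained, T \<alpha> x < r for positive r says that \<theta> x
    lies in the open set of points with coordinate below r, which gives upper semicontinuity. A
    supremum that is only approached would allow T \<alpha> x = r.\<close>
  have T_attained: "T \<alpha> x \<in> insert 0 (coord \<alpha> ` \<theta> x)" if x: "x \<in> topspace X" for \<alpha> x
    unfolding T_def
  proof (rule closed_contains_Sup)
    show "closed (insert 0 (coord \<alpha> ` \<theta> x))"
      by (rule compact_imp_closed[OF compact_coord[OF x]])
    show "bdd_above (insert 0 (coord \<alpha> ` \<theta> x))"
      by (rule bounded_imp_bdd_above[OF compact_imp_bounded[OF compact_coord[OF x]]])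
  qed simp
  have usc_T: "openin X {x \<in> topspace X. T \<alpha> x < r}" if \<alpha>: "\<alpha> \<in> A" for \<alpha> r
  proof (cases "0 < r")
    case True
    have "{x \<in> topspace X. T \<alpha> x < r} = {x \<in> topspace X. \<theta> x \<subseteq> {p \<in> hedgehog A. coord \<alpha> p < r}}"
    proof (intro Collect_cong conj_cong refl)
      fix x assume x: "x \<in> topspace X"
      show "T \<alpha> x < r \<longleftrightarrow> \<theta> x \<subseteq> {p \<in> hedgehog A. coord \<alpha> p < r}"
      proof
        assume less: "T \<alpha> x < r"
        show "\<theta> x \<subseteq> {p \<in> hedgehog A. coord \<alpha> p < r}"
        proof
          fix p assume p: "p \<in> \<theta> x"
          then have "coord \<alpha> p \<le> T \<alpha> x"
            by (intro T_upper[OF x]) simp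
          then show "p \<in> {p \<in> hedgehog A. coord \<alpha> p < r}"
            using less \<theta>_in_hedgehog[OF x p] by simp
        qed
      next
        assume "\<theta> x \<subseteq> {p \<in> hedgehog A. coord \<alpha> p < r}"
        then show "T \<alpha> x < r"
          using T_attained[OF x, of \<alpha>] True by auto
      qed
    qed
    then show ?thesis
      using openin_\<theta>_subset[OF openin_coord_less] by simp
  next
    case False
    have "0 \<le> T \<alpha> x" if "x \<in> topspace X" for x
      by (rule T_upper[OF that]) simp
    then have "{x \<in> topspace X. T \<alpha> x < r} = {}"
      using False by force
    then show ?thesis
      by (metis openin_empty)
  qed
  have lsc_B: "openin X {x \<in> topspace X. r < B \<alpha> x}" if \<alpha>: "\<alpha> \<in> A" for \<alpha> r
  proof (cases "r < 0")
    case True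
    then have "{x \<in> topspace X. r < B \<alpha> x} = topspace X"
      using B0[of _ \<alpha>] by (auto intro: less_le_trans)
    then show ?thesis
      by simp
  next
    case False
    have "{x \<in> topspace X. r < B \<alpha> x} = (\<Union>n\<in>{n. r < (1/2) ^ n}.
        U n \<alpha> \<inter> {x \<in> topspace X. \<Phi> x \<inter> {p \<in> hedgehog A. r < coord \<alpha> p} \<noteq> {}})" (is "?L = ?R")
    proof
      show "?L \<subseteq> ?R"
      proof
        fix x assume "x \<in> ?L"
        then have x: "x \<in> topspace X" "r < B \<alpha> x"
          by auto
        then obtain n p where "p \<in> \<Phi> x" "r < coord \<alpha> p" "r < (1/2) ^ n" "x \<in> U n \<alpha>"
          using B_greater[OF x(1), of r \<alpha>] False by blast
        then show "x \<in> ?R"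
          using x(1) \<Phi>_in_hedgehog[OF x(1)] by blast
      qed
      show "?R \<subseteq> ?L"
        using B_greater[of _ r \<alpha>] by auto
    qed
    moreover have "openin X ?R"
      using U(1)[OF \<alpha>] openin_\<Phi>_meets[OF openin_coord_greater] by (intro openin_Union) auto
    ultimately show ?thesis
      by simp
  qed
  have T_le_B: "T \<alpha> x \<le> B \<alpha> x" if \<alpha>: "\<alpha> \<in> A" and x: "x \<in> topspace X" for \<alpha> x
  proof (cases "T \<alpha> x \<le> 0")
    case True
    then show ?thesis
      using B0[OF x, of \<alpha>] by linarith
  next
    case False
    then obtain p where p: "p \<in> \<theta> x" "T \<alpha> x = coord \<alpha> p"
      using T_attained[OF x, of \<alpha>] by auto
    note pH = \<theta>_in_hedgehog[OF x p(1)]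
    \<comment> \<open>Both ends of the bracket are needed: the lower one puts x into
      \<open>E n \<alpha>\<close> and thus into \<open>U n \<alpha>\<close>, the upper one makes the
      cap \<open>(1/2) ^ n\<close> harmless at p.\<close>
    obtain n where n: "(1/2) ^ Suc n \<le> coord \<alpha> p" "coord \<alpha> p \<le> (1/2) ^ n"
      using dyadic_bracket[of "coord \<alpha> p"] False p(2) coord_le_1[OF pH, of \<alpha>] by auto
    have "x \<in> E n \<alpha>"
      using x p(1) pH n(1) by (auto simp: E_def)
    then have "x \<in> U n \<alpha>"
      using U(2)[OF \<alpha>] by blast
    then have "min (coord \<alpha> p) ((1/2) ^ n) \<in> S \<alpha> x"
      using p(1) \<theta>_subset[OF x] unfolding S_def by blast
    then have "min (coord \<alpha> p) ((1/2) ^ n) \<le> B \<alpha> x"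
      unfolding B_def by (rule cSup_upper[OF _ bdd_B[OF x]])
    then show ?thesis
      using n(2) p(2) by simp
  qed
  have "\<forall>\<alpha>\<in>A. \<exists>c. continuous_map X euclideanreal c \<and> (\<forall>x\<in>topspace X. T \<alpha> x \<le> c x \<and> c x \<le> B \<alpha> x)"
  proof
    fix \<alpha> assume \<alpha>: "\<alpha> \<in> A"
    show "\<exists>c. continuous_map X euclideanreal c \<and> (\<forall>x\<in>topspace X. T \<alpha> x \<le> c x \<and> c x \<le> B \<alpha> x)"
    proof (rule Katetov_Tong_insertion[OF normal usc_T[OF \<alpha>] lsc_B[OF \<alpha>] T_le_B[OF \<alpha>]])
      show "T \<alpha> x \<le> 1" if "x \<in> topspace X" for x
        using T_le_B[OF \<alpha> that] B1[OF that, of \<alpha>] by linarith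
      show "- 1 \<le> B \<alpha> x" if "x \<in> topspace X" for x
        using B0[OF that, of \<alpha>] by linarith
    qed
  qed
  from bchoice[OF this] obtain c where c: "\<And>\<alpha>. \<alpha> \<in> A \<Longrightarrow> continuous_map X euclideanreal (c \<alpha>)"
    "\<And>\<alpha> x. \<alpha> \<in> A \<Longrightarrow> x \<in> topspace X \<Longrightarrow> T \<alpha> x \<le> c \<alpha> x \<and> c \<alpha> x \<le> B \<alpha> x"
    by auto
  show thesis
  proof
    show "continuous_map X euclideanreal (c \<alpha>)" if "\<alpha> \<in> A" for \<alpha>
      by (rule c(1)[OF that])
    show "0 \<le> c \<alpha> x \<and> c \<alpha> x \<le> 1" if "\<alpha> \<in> A" "x \<in> topspace X" for \<alpha> x
      using c(2)[OF that] T_upper[OF that(2), of 0 \<alpha>] B1[OF that(2), of \<alpha>] by simp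
    show "coord \<alpha> p \<le> c \<alpha> x" if "\<alpha> \<in> A" "x \<in> topspace X" "p \<in> \<theta> x" for \<alpha> x p
      using c(2)[OF that(1,2)] T_upper[OF that(2), of "coord \<alpha> p" \<alpha>] that(3) by simp
    show "\<exists>p\<in>\<Phi> x. r < coord \<alpha> p" if "\<alpha> \<in> A" "x \<in> topspace X" "0 \<le> r" "r < c \<alpha> x" for \<alpha> x r
    proof -
      have "r < B \<alpha> x"
        using c(2)[OF that(1,2)] that(4) by simp
      then show ?thesis
        using B_greater[OF that(2), of r \<alpha>] that(3) by auto
    qed
    show "locally_finite_family X A (\<lambda>\<alpha>. {x \<in> topspace X. \<epsilon> \<le> c \<alpha> x})" if \<epsilon>: "0 < \<epsilon>" for \<epsilon>
    proof -
      \<comment> \<open>Half of \<epsilon> turns \<open>\<epsilon> \<le> c \<alpha> x\<close> into a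
        strict inequality for \<open>B\<close>, whose witness n has its cap above \<epsilon> / 2; so
        n < k and only the first k expansions matter.\<close>
      obtain k where k: "(1/2::real) ^ k < \<epsilon> / 2"
        using real_arch_pow_inv[of "\<epsilon> / 2" "1/2"] \<epsilon> by auto
      have sub: "{x \<in> topspace X. \<epsilon> \<le> c \<alpha> x} \<subseteq> (\<Union>n\<in>{..<k}. U n \<alpha>)" if \<alpha>: "\<alpha> \<in> A" for \<alpha>
      proof
        fix x assume "x \<in> {x \<in> topspace X. \<epsilon> \<le> c \<alpha> x}"
        then have x: "x \<in> topspace X" "\<epsilon> / 2 < B \<alpha> x"
          using c(2)[OF \<alpha>, of x] \<epsilon> by auto
        then obtain n where n: "\<epsilon> / 2 < (1/2) ^ n" "x \<in> U n \<alpha>"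
          using B_greater[OF x(1), of "\<epsilon> / 2" \<alpha>] \<epsilon> by auto
        have "n < k"
        proof (rule ccontr)
          assume "\<not> n < k"
          then have "(1/2::real) ^ n \<le> (1/2) ^ k"
            by (intro power_decreasing) auto
          then show False
            using n(1) k by linarith
        qed
        then show "x \<in> (\<Union>n\<in>{..<k}. U n \<alpha>)"
          using n(2) by blast
      qed
      have "locally_finite_family X A (\<lambda>\<alpha>. \<Union>n\<in>{..<k}. U n \<alpha>)"
        by (rule locally_finite_family_UN[OF finite_lessThan U(3)])
      then show ?thesis
        by (rule locally_finite_family_mono[OF _ subset_refl sub])
    qed
  qed
qed

theorem continuous_insertion:
  assumes A: "A \<noteq> {}" and \<tau>: "card_paracompact_space \<tau> X" "Cinfinite \<tau>" "|A| \<le>o \<tau>"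
  shows "\<exists>\<phi>. \<phi> \<in> topspace X \<rightarrow> compact_conn_hyp (hedgehog_space A) \<and>
    continuous_set_map X (hedgehog_space A) \<phi> \<and>
    (\<forall>x\<in>topspace X. \<theta> x \<subseteq> \<phi> x \<and> \<phi> x \<subseteq> \<Phi> x)"
proof -
  interpret Metric_space "hedgehog A" hedgehog_dist
    by (rule Metric_space_hedgehog)
  obtain e where e: "continuous_map X euclideanreal e"
    "\<And>x. x \<in> topspace X \<Longrightarrow> 0 \<le> e x \<and> e x \<le> 1"
    "\<And>x r. x \<in> topspace X \<Longrightarrow> e x < r \<Longrightarrow> \<exists>p\<in>\<Phi> x. height p < r"
    "\<And>x. x \<in> topspace X \<Longrightarrow> 0 < e x \<Longrightarrow> \<exists>\<alpha>\<in>A. \<forall>p\<in>\<theta> x. e x \<le> coord \<alpha> p"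
    using lower_function by blast
  obtain c where c: "\<And>\<alpha>. \<alpha> \<in> A \<Longrightarrow> continuous_map X euclideanreal (c \<alpha>)"
    "\<And>\<alpha> x. \<alpha> \<in> A \<Longrightarrow> x \<in> topspace X \<Longrightarrow> 0 \<le> c \<alpha> x \<and> c \<alpha> x \<le> 1"
    "\<And>\<alpha> x p. \<alpha> \<in> A \<Longrightarrow> x \<in> topspace X \<Longrightarrow> p \<in> \<theta> x \<Longrightarrow> coord \<alpha> p \<le> c \<alpha> x"
    "\<And>\<alpha> x r. \<alpha> \<in> A \<Longrightarrow> x \<in> topspace X \<Longrightarrow> 0 \<le> r \<Longrightarrow> r < c \<alpha> x \<Longrightarrow> \<exists>p\<in>\<Phi> x. r < coord \<alpha> p"
    "\<And>\<epsilon>. 0 < \<epsilon> \<Longrightarrow> locally_finite_family X A (\<lambda>\<alpha>. {x \<in> topspace X. \<epsilon> \<le> c \<alpha> x})"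
    using upper_functions[OF \<tau>] by blast
  \<comment> \<open>Where e x = 0 an arbitrary spine serves as default.\<close>
  have "\<exists>\<alpha>. \<alpha> \<in> A \<and> (0 < e x \<longrightarrow> (\<forall>p\<in>\<theta> x. e x \<le> coord \<alpha> p))" if "x \<in> topspace X" for x
    using e(4)[OF that] A by blast
  then have "\<forall>x\<in>topspace X. \<exists>\<alpha>. \<alpha> \<in> A \<and> (0 < e x \<longrightarrow> (\<forall>p\<in>\<theta> x. e x \<le> coord \<alpha> p))"
    by blast
  from bchoice[OF this] obtain a where a: "\<And>x. x \<in> topspace X \<Longrightarrow> a x \<in> A"
    "\<And>x p. x \<in> topspace X \<Longrightarrow> 0 < e x \<Longrightarrow> p \<in> \<theta> x \<Longrightarrow> e x \<le> coord (a x) p"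
    by auto
  define S where "S x = star A (\<lambda>\<alpha>. c \<alpha> x)" for x
  define \<phi> where "\<phi> x = push (e x) (a x) ` S x" for x
  have S_sub: "p \<in> hedgehog A" if "p \<in> S x" for p x
    using that by (simp add: S_def star_def)
  have S_compact: "compactin (hedgehog_space A) (S x)" if x: "x \<in> topspace X" for x
    unfolding S_def
  proof (rule compactin_star[OF A])
    fix \<epsilon> :: real assume \<epsilon>: "0 < \<epsilon>"
    obtain N where N: "x \<in> N" "finite {\<alpha> \<in> A. {x \<in> topspace X. \<epsilon> \<le> c \<alpha> x} \<inter> N \<noteq> {}}"
      by (rule locally_finite_familyD[OF c(5)[OF \<epsilon>] x])
    have "{\<alpha> \<in> A. \<epsilon> \<le> c \<alpha> x} \<subseteq> {\<alpha> \<in> A. {x \<in> topspace X. \<epsilon> \<le> c \<alpha> x} \<inter> N \<noteq> {}}"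
      using N(1) x by blast
    then show "finite {\<alpha> \<in> A. \<epsilon> \<le> c \<alpha> x}"
      using N(2) by (rule finite_subset)
  qed (use c(2) x in auto)
  have S_connected: "connectedin (hedgehog_space A) (S x)" if x: "x \<in> topspace X" for x
    unfolding S_def by (rule connectedin_star[OF A]) (use c(2) x in auto)
  have cont_push: "continuous_map (hedgehog_space A) (hedgehog_space A) (push (e x) (a x))"
    if x: "x \<in> topspace X" for x
    using e(2)[OF x] by (intro continuous_map_push a x) auto
  have \<phi>_compact: "compactin (hedgehog_space A) (\<phi> x)" if x: "x \<in> topspace X" for x
    unfolding \<phi>_def by (rule image_compactin[OF S_compact[OF x] cont_push[OF x]])
  have \<phi>_connected: "connectedin (hedgehog_space A) (\<phi> x)" if x: "x \<in> topspace X" for x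
    unfolding \<phi>_def by (rule connectedin_continuous_map_image[OF cont_push[OF x] S_connected[OF x]])
  have \<theta>_sub_\<phi>: "\<theta> x \<subseteq> \<phi> x" if x: "x \<in> topspace X" for x
  proof
    fix p assume p: "p \<in> \<theta> x"
    note pH = \<theta>_in_hedgehog[OF x p]
    have "p \<in> S x"
      using c(3)[OF _ x p] pH by (simp add: S_def star_def)
    moreover have "push (e x) (a x) p = p"
    proof (cases "0 < e x")
      case True
      then show ?thesis
        by (intro push_fixed[OF pH]) (use a(2)[OF x True p] in auto)
    next
      case False
      then have "e x = 0"
        using e(2)[OF x] by simp
      then show ?thesis
        using push_0[OF pH] by simp
    qed
    ultimately show "p \<in> \<phi> x"
      unfolding \<phi>_def by (metis imageI)
  qed
  have e_le_c: "e x \<le> c (a x) x" if x: "x \<in> topspace X" for x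
  proof (cases "0 < e x")
    case True
    obtain p where p: "p \<in> \<theta> x"
      using \<theta>_nonempty[OF x] by blast
    show ?thesis
      using a(2)[OF x True p] c(3)[OF a(1)[OF x] x p] by linarith
  next
    case False
    then show ?thesis
      using c(2)[OF a(1)[OF x] x] by linarith
  qed
  have \<phi>_sub_S: "\<phi> x \<subseteq> S x" if x: "x \<in> topspace X" for x
    unfolding \<phi>_def S_def
    using e(2)[OF x] e_le_c[OF x] a(1)[OF x] c(2)[OF _ x]
    by (intro image_subsetI push_star) auto
  \<comment> \<open>If \<Phi> x contains the origin, it contains the whole star, and pushing stays
    within the star. Otherwise e x is positive and \<Phi> x lies on the spine a x; every other
    extent c \<beta> x is 0, since a positive one would give \<Phi> x a point on \<beta>. Then
    \<phi> x is the segment from e x to c (a x) x.\<close>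
  have \<phi>_sub_\<Phi>: "\<phi> x \<subseteq> \<Phi> x" if x: "x \<in> topspace X" for x
  proof (cases "Origin \<in> \<Phi> x")
    case True
    have "p \<in> \<Phi> x" if p: "p \<in> S x" for p
    proof (cases p)
      case (Spine s \<alpha>)
      then have s: "\<alpha> \<in> A" "0 < s" "s \<le> 1" "s \<le> c \<alpha> x"
        using p by (auto simp: S_def star_def)
      have "spine_point \<alpha> s \<in> \<Phi> x"
      proof (rule closed_connected_hedgehog_limit[OF closed_\<Phi>[OF x] connected_\<Phi>[OF x] s(1)])
        fix \<epsilon> :: real assume \<epsilon>: "0 < \<epsilon>"
        show "\<exists>p\<in>\<Phi> x. coord \<alpha> p < s + \<epsilon>"
          using True s \<epsilon> by (intro bexI[of _ Origin]) auto
        show "\<exists>q\<in>\<Phi> x. s - \<epsilon> < coord \<alpha> q"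
        proof (cases "0 \<le> s - \<epsilon>")
          case True
          then show ?thesis
            using c(4)[OF s(1) x, of "s - \<epsilon>"] s \<epsilon> by simp
        next
          case False
          then show ?thesis
            using \<open>Origin \<in> \<Phi> x\<close> by (intro bexI[of _ Origin]) auto
        qed
      qed (use s in auto)
      then show ?thesis
        using Spine s(2) by (simp add: spine_point_def)
    qed (use True in simp)
    then show ?thesis
      using \<phi>_sub_S[OF x] by blast
  next
    case False
    have "Origin \<in> hedgehog A - \<Phi> x"
      using False by simp
    then obtain \<rho> where \<rho>: "\<rho> > 0" "disjnt (\<Phi> x) (mball Origin \<rho>)"
      using closed_\<Phi>[OF x] unfolding hedgehog_space_def closedin_metric by blast
    have e_pos: "0 < e x"
    proof (rule ccontr)
      assume "\<not> 0 < e x"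
      then obtain p where p: "p \<in> \<Phi> x" "height p < \<rho>"
        using e(3)[OF x, of \<rho>] \<rho>(1) by fastforce
      then have "p \<in> mball Origin \<rho>"
        using \<Phi>_in_hedgehog[OF x] by simp
      then show False
        using \<rho>(2) p(1) by (auto simp: disjnt_iff)
    qed
    obtain p0 where p0: "p0 \<in> \<theta> x"
      using \<theta>_nonempty[OF x] by blast
    have p0_pos: "0 < coord (a x) p0"
      using a(2)[OF x e_pos p0] e_pos by linarith
    have pos: "0 < coord (a x) q" if "q \<in> \<Phi> x" for q
      using \<Phi>_positive_coord[OF x False _ p0_pos that] p0 \<theta>_subset[OF x] by blast
    have segment: "spine_point (a x) r \<in> \<Phi> x" if r: "e x \<le> r" "r \<le> c (a x) x" for r
    proof (rule closed_connected_hedgehog_limit[OF closed_\<Phi>[OF x] connected_\<Phi>[OF x] a(1)[OF x]])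
      show "0 \<le> r" "r \<le> 1"
        using r e_pos c(2)[OF a(1)[OF x] x] by linarith+
      fix \<epsilon> :: real assume \<epsilon>: "0 < \<epsilon>"
      obtain p where p: "p \<in> \<Phi> x" "height p < r + \<epsilon>"
        using e(3)[OF x, of "r + \<epsilon>"] r \<epsilon> by auto
      then show "\<exists>p\<in>\<Phi> x. coord (a x) p < r + \<epsilon>"
        using coord_le_height[OF \<Phi>_in_hedgehog[OF x p(1)], of "a x"] by (intro bexI[of _ p]) auto
      show "\<exists>q\<in>\<Phi> x. r - \<epsilon> < coord (a x) q"
      proof (cases "0 \<le> r - \<epsilon>")
        case True
        then show ?thesis
          using c(4)[OF a(1)[OF x] x, of "r - \<epsilon>"] r \<epsilon> by simp
      next
        case neg: False
        then show ?thesis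
          using pos[OF p(1)] p(1) by (intro bexI[of _ p]) auto
      qed
    qed
    have "push (e x) (a x) p \<in> \<Phi> x" if p: "p \<in> S x" for p
    proof (cases p)
      case Origin
      then show ?thesis
        using segment[OF order_refl e_le_c[OF x]] by (simp add: push_def)
    next
      case (Spine s \<beta>)
      then have s: "\<beta> \<in> A" "0 < s" "s \<le> c \<beta> x"
        using p by (auto simp: S_def star_def)
      obtain q where q: "q \<in> \<Phi> x" "0 < coord \<beta> q"
        using c(4)[OF s(1) x, of 0] s by auto
      then have "\<beta> = a x"
        using coord_pos_unique[OF \<Phi>_in_hedgehog[OF x q(1)] q(2) pos[OF q(1)]] by simp
      then show ?thesis
        using segment[of "max s (e x)"] s e_pos e_le_c[OF x] Spine
        by (simp add: push_def spine_point_def max_def split: if_splits)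
    qed
    then show ?thesis
      by (auto simp: \<phi>_def)
  qed
  \<comment> \<open>If e x > 0, upper semicontinuity keeps \<theta> y on the spine a x, while e y >
    0 puts it on a y, so a y = a x and only the amount of pushing varies. If e x = 0, the push at x
    is also the push by 0 along a y, so the spines agree again.\<close>
  have push_near: "\<exists>N. openin X N \<and> x \<in> N \<and>
      (\<forall>y\<in>N. \<forall>p\<in>hedgehog A. hedgehog_dist (push (e x) (a x) p) (push (e y) (a y) p) < \<epsilon>)"
    if x: "x \<in> topspace X" and \<epsilon>: "0 < \<epsilon>" for x \<epsilon>
  proof (cases "0 < e x")
    case True
    let ?N = "{y \<in> topspace X. 0 < e y} \<inter> {y \<in> topspace X. e x - \<epsilon> < e y} \<inter> {y \<in> topspace X. e y < e x + \<epsilon>} \<inter>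
        {y \<in> topspace X. \<theta> y \<subseteq> {p \<in> hedgehog A. 0 < coord (a x) p}}"
    have "openin X ?N"
      using e(1) unfolding continuous_map_upper_lower_semicontinuous_lt
      by (intro openin_Int openin_\<theta>_subset openin_coord_greater) auto
    moreover have "x \<in> ?N"
      using x True \<epsilon> a(2)[OF x True] \<theta>_in_hedgehog[OF x] by force
    moreover have "hedgehog_dist (push (e x) (a x) p) (push (e y) (a y) p) < \<epsilon>"
      if y: "y \<in> ?N" and p: "p \<in> hedgehog A" for y p
    proof -
      have yX: "y \<in> topspace X" and ey: "0 < e y" "\<bar>e x - e y\<bar> < \<epsilon>"
        using y by auto
      obtain q where q: "q \<in> \<theta> y"
        using \<theta>_nonempty[OF yX] by blast
      have "0 < coord (a x) q" "0 < coord (a y) q"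
        using y q a(2)[OF yX ey(1) q] ey(1) by auto
      then have "a x = a y"
        by (rule coord_pos_unique[OF \<theta>_in_hedgehog[OF yX q]])
      then show ?thesis
        using hedgehog_dist_push_push[OF _ _ p, of "e x" "e y" "a y"] True ey by simp
    qed
    ultimately show ?thesis
      by (intro exI[of _ ?N]) blast
  next
    case False
    then have ex: "e x = 0"
      using e(2)[OF x] by simp
    let ?N = "{y \<in> topspace X. e y < \<epsilon>}"
    have "openin X ?N"
      using e(1) unfolding continuous_map_upper_lower_semicontinuous_lt by blast
    moreover have "x \<in> ?N"
      using x ex \<epsilon> by simp
    moreover have "hedgehog_dist (push (e x) (a x) p) (push (e y) (a y) p) < \<epsilon>"
      if y: "y \<in> ?N" and p: "p \<in> hedgehog A" for y p
      using hedgehog_dist_push_push[OF order_refl _ p, of "e y" "a y"] e(2)[of y] y ex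
        push_0[OF p, of "a x"] push_0[OF p, of "a y"] by auto
    ultimately show ?thesis
      by (intro exI[of _ ?N]) blast
  qed
  have "continuous_set_map X mtopology \<phi>"
  proof (rule continuous_set_map_metricI)
    show "compactin mtopology (\<phi> x)" if "x \<in> topspace X" for x
      using \<phi>_compact[OF that] by (simp add: hedgehog_space_def)
    fix x and \<epsilon> :: real assume x: "x \<in> topspace X" and \<epsilon>: "0 < \<epsilon>"
    obtain M where M: "openin X M" "x \<in> M"
      "\<forall>y\<in>M. \<forall>p\<in>hedgehog A. hedgehog_dist (push (e x) (a x) p) (push (e y) (a y) p) < \<epsilon> / 2"
      using push_near[OF x, of "\<epsilon> / 2"] \<epsilon> by auto
    have "\<exists>N. openin X N \<and> x \<in> N \<and> (\<forall>y\<in>N. \<forall>\<alpha>\<in>A. \<bar>c \<alpha> x - c \<alpha> y\<bar> < \<epsilon> / 2)"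
      by (rule continuous_family_uniform[OF c(1) _ c(5) x]) (use c(2) \<epsilon> in auto)
    then obtain N where N: "openin X N" "x \<in> N" "\<forall>y\<in>N. \<forall>\<alpha>\<in>A. \<bar>c \<alpha> x - c \<alpha> y\<bar> < \<epsilon> / 2"
      by blast
    \<comment> \<open>One half of \<epsilon> pays for replacing p by q under the same nonexpansive
      push, the other for changing the push at q.\<close>
    have close: "hedgehog_dist (push (e x) (a x) p) (push (e y) (a y) q) < \<epsilon>"
      if "y \<in> M" "y \<in> topspace X" "p \<in> hedgehog A" "q \<in> hedgehog A" "hedgehog_dist p q < \<epsilon> / 2" for y p q
    proof -
      have in_H: "push (e x) (a x) p \<in> hedgehog A" "push (e x) (a x) q \<in> hedgehog A"
        "push (e y) (a y) q \<in> hedgehog A"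
        using that x a(1) e(2) by (auto intro!: push_in_hedgehog)
      have "hedgehog_dist (push (e x) (a x) p) (push (e x) (a x) q) < \<epsilon> / 2"
        using hedgehog_dist_push[OF _ that(3,4), of "e x" "a x"] e(2)[OF x] that(5) by linarith
      moreover have "hedgehog_dist (push (e x) (a x) q) (push (e y) (a y) q) < \<epsilon> / 2"
        using M(3) that(1,4) by blast
      ultimately show ?thesis
        using triangle[OF in_H] by linarith
    qed
    have "(\<forall>p\<in>\<phi> x. \<exists>q\<in>\<phi> y. hedgehog_dist p q < \<epsilon>) \<and> (\<forall>q\<in>\<phi> y. \<exists>p\<in>\<phi> x. hedgehog_dist p q < \<epsilon>)"
      if y: "y \<in> M \<inter> N" for y
    proof -
      have yX: "y \<in> topspace X" "y \<in> M"
        using y openin_subset[OF M(1)] by auto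
      have near: "\<bar>c \<alpha> x - c \<alpha> y\<bar> < \<epsilon> / 2" "\<bar>c \<alpha> y - c \<alpha> x\<bar> < \<epsilon> / 2" if "\<alpha> \<in> A" for \<alpha>
        using N(3) y that by (auto simp: abs_minus_commute)
      have 1: "\<exists>q\<in>S y. hedgehog_dist p q < \<epsilon> / 2" if "p \<in> S x" for p
        using that unfolding S_def
        by (intro star_near[of A "\<lambda>\<alpha>. c \<alpha> x" "\<lambda>\<alpha>. c \<alpha> y"]) (use c(2) x yX(1) near \<epsilon> in auto)
      have 2: "\<exists>p\<in>S x. hedgehog_dist q p < \<epsilon> / 2" if "q \<in> S y" for q
        using that unfolding S_def
        by (intro star_near[of A "\<lambda>\<alpha>. c \<alpha> y" "\<lambda>\<alpha>. c \<alpha> x"]) (use c(2) x yX(1) near \<epsilon> in auto)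
      show ?thesis
      proof (intro conjI ballI)
        fix P assume "P \<in> \<phi> x"
        then obtain p where p: "p \<in> S x" "P = push (e x) (a x) p"
          unfolding \<phi>_def by blast
        obtain q where q: "q \<in> S y" "hedgehog_dist p q < \<epsilon> / 2"
          using 1[OF p(1)] by blast
        show "\<exists>Q\<in>\<phi> y. hedgehog_dist P Q < \<epsilon>"
          using close[OF yX(2,1) S_sub[OF p(1)] S_sub[OF q(1)] q(2)] p(2) q(1)
          unfolding \<phi>_def by blast
      next
        fix Q assume "Q \<in> \<phi> y"
        then obtain q where q: "q \<in> S y" "Q = push (e y) (a y) q"
          unfolding \<phi>_def by blast
        obtain p where p: "p \<in> S x" "hedgehog_dist q p < \<epsilon> / 2"
          using 2[OF q(1)] by blast
        have "hedgehog_dist p q < \<epsilon> / 2"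
          using p(2) commute[of p q] by simp
        then show "\<exists>P\<in>\<phi> x. hedgehog_dist P Q < \<epsilon>"
          using close[OF yX(2,1) S_sub[OF p(1)] S_sub[OF q(1)]] q(2) p(1)
          unfolding \<phi>_def by blast
      qed
    qed
    then show "\<exists>N. openin X N \<and> x \<in> N \<and> (\<forall>y\<in>N.
        (\<forall>p\<in>\<phi> x. \<exists>q\<in>\<phi> y. hedgehog_dist p q < \<epsilon>) \<and> (\<forall>q\<in>\<phi> y. \<exists>p\<in>\<phi> x. hedgehog_dist p q < \<epsilon>))"
      using M(1,2) N(1,2) by (intro exI[of _ "M \<inter> N"]) auto
  qed
  moreover have "\<phi> x \<in> compact_conn_hyp (hedgehog_space A)" if x: "x \<in> topspace X" for x
    using \<phi>_compact[OF x] \<phi>_connected[OF x] \<theta>_sub_\<phi>[OF x] \<theta>_nonempty[OF x]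
    by (auto simp: compact_conn_hyp_def compact_hyp_def)
  ultimately show ?thesis
    using \<theta>_sub_\<phi> \<phi>_sub_\<Phi> by (intro exI[of _ \<phi>]) (auto simp: hedgehog_space_def)
qed

end

subsection \<open>Strict insertion\<close>

lemma Hausdorff_hedgehog_space: "Hausdorff_space (hedgehog_space A)"
  unfolding hedgehog_space_def
  by (rule Metric_space.Hausdorff_space_mtopology[OF Metric_space_hedgehog])

lemma closedin_star:
  assumes "A \<noteq> {}"
  shows "closedin (hedgehog_space A) (star A c)"
proof -
  have "closedin (hedgehog_space A) {p \<in> hedgehog A. coord \<alpha> p \<le> r}" for \<alpha> r
  proof -
    have "hedgehog A - {p \<in> hedgehog A. coord \<alpha> p \<le> r} = {p \<in> hedgehog A. r < coord \<alpha> p}"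
      by auto
    then show ?thesis
      using openin_coord_greater by (auto simp: closedin_def topspace_hedgehog_space)
  qed
  then have "closedin (hedgehog_space A) (\<Inter>\<alpha>\<in>A. {p \<in> hedgehog A. coord \<alpha> p \<le> c \<alpha>})"
    using assms by (intro closedin_Inter) auto
  moreover have "star A c = (\<Inter>\<alpha>\<in>A. {p \<in> hedgehog A. coord \<alpha> p \<le> c \<alpha>})"
    using assms by (auto simp: star_def)
  ultimately show ?thesis
    by simp
qed

definition strict_insertion_property :: "'a topology \<Rightarrow> 'b set \<Rightarrow> bool" where
  "strict_insertion_property X A \<longleftrightarrow> (\<forall>\<Phi> \<theta>.
      \<Phi> \<in> topspace X \<rightarrow> closed_conn_hyp (hedgehog_space A) \<and>
      lsc_map X (hedgehog_space A) \<Phi> \<and>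
      \<theta> \<in> topspace X \<rightarrow> compact_hyp (hedgehog_space A) \<and>
      usc_map X (hedgehog_space A) \<theta> \<and>
      selection_less X \<theta> \<Phi> \<longrightarrow>
      (\<exists>\<phi>. \<phi> \<in> topspace X \<rightarrow> compact_conn_hyp (hedgehog_space A) \<and>
        continuous_set_map X (hedgehog_space A) \<phi> \<and>
        selection_less X \<theta> \<phi> \<and> selection_le X \<phi> \<Phi>))"

text \<open>A point of \<Phi> x - \<theta> x itself need not stay in \<Phi> y for y near x. A height
  v that \<Phi> x straddles and \<theta> x avoids does persist: straddling is open by lower
  semicontinuity, avoiding by upper semicontinuity, and connectedness of \<Phi> y yields the point
  at height v. A rational v keeps the number of such open sets within \<tau>.\<close>

lemma point_between_hedgehog:
  assumes C: "closedin (hedgehog_space A) C" "C \<noteq> {}" and D: "C \<subseteq> D" "D - C \<noteq> {}" "D \<subseteq> hedgehog A"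
  shows "\<exists>v::rat. 0 < v \<and> (\<exists>\<alpha>\<in>A. (\<exists>p\<in>D. coord \<alpha> p < of_rat v) \<and> (\<exists>q\<in>D. of_rat v < coord \<alpha> q) \<and>
    (\<forall>p\<in>C. coord \<alpha> p \<noteq> of_rat v))"
proof -
  interpret Metric_space "hedgehog A" hedgehog_dist
    by (rule Metric_space_hedgehog)
  obtain q where q: "q \<in> D" "q \<notin> C"
    using D(2) by blast
  obtain p where p: "p \<in> C"
    using C(2) by blast
  have pD: "p \<in> D" and pH: "p \<in> hedgehog A" and qH: "q \<in> hedgehog A" and CH: "C \<subseteq> hedgehog A"
    using p q D by auto
  have "q \<in> hedgehog A - C"
    using qH q by simp
  then obtain \<delta> where \<delta>: "\<delta> > 0" "disjnt C (mball q \<delta>)"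
    using C(1) unfolding hedgehog_space_def closedin_metric by blast
  have avoid: "coord \<alpha> z \<noteq> v" if "0 \<le> v" "\<bar>v - coord \<alpha> q\<bar> < \<delta>" "z \<in> C" for z \<alpha> v
  proof
    assume eq: "coord \<alpha> z = v"
    have zH: "z \<in> hedgehog A"
      using that(3) CH by blast
    then have "z = spine_point \<alpha> v"
      using coord_eq_iff[OF zH, of \<alpha>] eq that(1) by simp
    then have "hedgehog_dist q z < \<delta>"
      using hedgehog_dist_spine_point[OF qH that(1), of \<alpha>] that(2) by simp
    then have "z \<in> mball q \<delta>"
      using qH zH by simp
    then show False
      using \<delta>(2) that(3) by (auto simp: disjnt_iff)
  qed
  \<comment> \<open>The spine of q, or that of p if q is the origin.\<close>
  have "\<exists>\<alpha>\<in>A. coord \<alpha> p \<noteq> coord \<alpha> q \<and> 0 < max (coord \<alpha> p) (coord \<alpha> q) \<and> 0 \<le> coord \<alpha> q"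
  proof (cases q)
    case (Spine s \<alpha>)
    then show ?thesis
      using qH pH p q coord_eq_iff[OF pH, of \<alpha>] by (intro bexI[of _ \<alpha>]) (auto simp: spine_point_def)
  next
    case Origin
    then obtain s \<alpha> where "p = Spine s \<alpha>"
      using p q by (cases p) auto
    then show ?thesis
      using Origin pH by (intro bexI[of _ \<alpha>]) auto
  qed
  then obtain \<alpha> where \<alpha>: "\<alpha> \<in> A" "coord \<alpha> p \<noteq> coord \<alpha> q" "0 < max (coord \<alpha> p) (coord \<alpha> q)"
    "0 \<le> coord \<alpha> q"
    by blast
  \<comment> \<open>The height v has to be positive, strictly between the coordinates of p and q,
    and within \<delta> of that of q, since the ball of radius \<delta> at q misses
    \<open>C\<close>.\<close>
  let ?lo = "max 0 (max (min (coord \<alpha> p) (coord \<alpha> q)) (coord \<alpha> q - \<delta>))"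
  let ?hi = "min (max (coord \<alpha> p) (coord \<alpha> q)) (coord \<alpha> q + \<delta>)"
  have "?lo < ?hi"
    using \<alpha> \<delta>(1) by (auto simp: max_def min_def)
  then obtain v where v: "?lo < of_rat v" "of_rat v < ?hi"
    using of_rat_dense by blast
  have v_q: "0 < (of_rat v :: real)" "\<bar>of_rat v - coord \<alpha> q\<bar> < \<delta>"
    using v by (linarith+)
  have "(\<exists>p\<in>D. coord \<alpha> p < of_rat v) \<and> (\<exists>q\<in>D. of_rat v < coord \<alpha> q)"
  proof (cases "coord \<alpha> p < coord \<alpha> q")
    case True
    then have "coord \<alpha> p < of_rat v" "of_rat v < coord \<alpha> q"
      using v by linarith+
    then show ?thesis
      using pD q(1) by blast
  next
    case False
    then have "coord \<alpha> q < of_rat v" "of_rat v < coord \<alpha> p"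
      using v by linarith+
    then show ?thesis
      using pD q(1) by blast
  qed
  moreover have "0 < v"
    using v_q(1) by simp
  moreover have "\<forall>z\<in>C. coord \<alpha> z \<noteq> of_rat v"
    using avoid[OF less_imp_le[OF v_q(1)] v_q(2)] by blast
  ultimately show ?thesis
    using \<alpha>(1) by blast
qed

lemma normal_card_paracompact_imp_strict_insertion:
  assumes \<tau>: "Cinfinite \<tau>" "|A| \<le>o \<tau>" and A: "A \<noteq> {}"
    and X: "normal_space X" "card_paracompact_space \<tau> X"
  shows "strict_insertion_property X A"
  unfolding strict_insertion_property_def
proof (intro allI impI, elim conjE)
  fix \<Phi> \<theta>
  assume \<Phi>: "\<Phi> \<in> topspace X \<rightarrow> closed_conn_hyp (hedgehog_space A)" "lsc_map X (hedgehog_space A) \<Phi>"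
    and \<theta>: "\<theta> \<in> topspace X \<rightarrow> compact_hyp (hedgehog_space A)" "usc_map X (hedgehog_space A) \<theta>"
    and less: "selection_less X \<theta> \<Phi>"
  have \<Phi>_props: "closedin (hedgehog_space A) (\<Phi> x)" "connectedin (hedgehog_space A) (\<Phi> x)"
    "\<Phi> x \<subseteq> hedgehog A" if "x \<in> topspace X" for x
  proof -
    have "\<Phi> x \<in> closed_conn_hyp (hedgehog_space A)"
      using \<Phi>(1) that by blast
    then show "closedin (hedgehog_space A) (\<Phi> x)" "connectedin (hedgehog_space A) (\<Phi> x)"
      by (auto simp: closed_conn_hyp_def closed_hyp_def)
    then show "\<Phi> x \<subseteq> hedgehog A"
      using closedin_subset by (fastforce simp: topspace_hedgehog_space)
  qed
  have \<theta>_props: "compactin (hedgehog_space A) (\<theta> x)" "\<theta> x \<noteq> {}" "\<theta> x \<subseteq> \<Phi> x" "\<Phi> x - \<theta> x \<noteq> {}"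
    "\<theta> x \<subseteq> hedgehog A" if x: "x \<in> topspace X" for x
  proof -
    have "\<theta> x \<in> compact_hyp (hedgehog_space A)"
      using \<theta>(1) that by blast
    then show "compactin (hedgehog_space A) (\<theta> x)" "\<theta> x \<noteq> {}"
      by (auto simp: compact_hyp_def)
    show "\<theta> x \<subseteq> \<Phi> x" "\<Phi> x - \<theta> x \<noteq> {}"
      using less x by (auto simp: selection_less_def selection_le_def)
    then show "\<theta> x \<subseteq> hedgehog A"
      using \<Phi>_props(3)[OF x] by blast
  qed
  define I where "I = {v::rat. 0 < v} \<times> A"
  define V where "V i = {x \<in> topspace X. \<Phi> x \<inter> {p \<in> hedgehog A. coord (snd i) p < of_rat (fst i)} \<noteq> {}} \<inter>
      {x \<in> topspace X. \<Phi> x \<inter> {p \<in> hedgehog A. of_rat (fst i) < coord (snd i) p} \<noteq> {}} \<inter>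
      {x \<in> topspace X. \<theta> x \<subseteq> {p \<in> hedgehog A. coord (snd i) p < of_rat (fst i)} \<union>
        {p \<in> hedgehog A. of_rat (fst i) < coord (snd i) p}}" for i :: "rat \<times> 'b"
  define pt where "pt i = spine_point (snd i) (of_rat (fst i))" for i :: "rat \<times> 'b"
  have "|I| \<le>o \<tau>"
  proof -
    have inf: "infinite (Field \<tau>)" and card: "Card_order \<tau>"
      using \<tau>(1) by (auto simp: cinfinite_def)
    have "|{v::rat. 0 < v}| \<le>o |UNIV :: nat set|"
      by (rule card_of_ordLeqI[of to_nat]) (auto intro: inj_on_subset[OF inj_to_nat])
    moreover have "|UNIV :: nat set| \<le>o \<tau>"
      using inf card infinite_iff_card_of_nat card_of_Field_ordIso ordLeq_ordIso_trans by blast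
    ultimately have "|{v::rat. 0 < v}| \<le>o \<tau>"
      by (rule ordLeq_transitive)
    then show ?thesis
      unfolding I_def by (rule card_of_Times_ordLeq_infinite_Field[OF inf _ \<tau>(2) card])
  qed
  moreover have "openin X (V i)" for i
  proof -
    have lsc: "openin X {x \<in> topspace X. \<Phi> x \<inter> U \<noteq> {}}" if "openin (hedgehog_space A) U" for U
      by (rule lsc_map_openin_meets[OF \<Phi>(2) that])
    have usc: "openin X {x \<in> topspace X. \<theta> x \<subseteq> U}" if "openin (hedgehog_space A) U" for U
      by (rule usc_map_openin_subset[OF \<theta>(2) that])
        (use \<theta>_props(5) in \<open>simp add: topspace_hedgehog_space\<close>)
    show ?thesis
      unfolding V_def
      by (intro openin_Int lsc usc openin_Un openin_coord_less openin_coord_greater)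
  qed
  moreover have "topspace X \<subseteq> (\<Union>i\<in>I. V i)"
  proof
    fix x assume x: "x \<in> topspace X"
    have "closedin (hedgehog_space A) (\<theta> x)"
      by (rule compactin_imp_closedin[OF Hausdorff_hedgehog_space \<theta>_props(1)[OF x]])
    from point_between_hedgehog[OF this \<theta>_props(2-4)[OF x] \<Phi>_props(3)[OF x]]
    obtain v :: rat and \<alpha> where v: "0 < v" "\<alpha> \<in> A" "\<exists>p\<in>\<Phi> x. coord \<alpha> p < of_rat v"
      "\<exists>q\<in>\<Phi> x. of_rat v < coord \<alpha> q" "\<forall>p\<in>\<theta> x. coord \<alpha> p \<noteq> of_rat v"
      by blast
    have "x \<in> V (v, \<alpha>)"
      unfolding V_def fst_conv snd_conv
    proof (intro IntI CollectI conjI x)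
      show "\<Phi> x \<inter> {p \<in> hedgehog A. coord \<alpha> p < of_rat v} \<noteq> {}"
        "\<Phi> x \<inter> {p \<in> hedgehog A. of_rat v < coord \<alpha> p} \<noteq> {}"
        using v(3,4) \<Phi>_props(3)[OF x] by blast+
      show "\<theta> x \<subseteq> {p \<in> hedgehog A. coord \<alpha> p < of_rat v} \<union> {p \<in> hedgehog A. of_rat v < coord \<alpha> p}"
        using v(5) \<theta>_props(5)[OF x] by (force simp: neq_iff)
    qed
    then show "x \<in> (\<Union>i\<in>I. V i)"
      using v(1,2) by (auto simp: I_def)
  qed
  ultimately obtain K where K: "\<And>i. i \<in> I \<Longrightarrow> closedin X (K i)" "\<And>i. i \<in> I \<Longrightarrow> K i \<subseteq> V i"
    "topspace X \<subseteq> (\<Union>i\<in>I. K i)" "locally_finite_family X I K"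
    using normal_card_paracompact_closed_refinement[OF X \<tau>(1), of I V] by (metis (lifting))
  have pt_\<Phi>: "pt i \<in> \<Phi> x" and pt_\<theta>: "pt i \<notin> \<theta> x" if i: "i \<in> I" "x \<in> K i" for i x
  proof -
    have x: "x \<in> V i" "x \<in> topspace X"
      using K(2)[OF i(1)] i(2) by (auto simp: V_def)
    have pos: "0 < (of_rat (fst i) :: real)"
      using i(1) by (auto simp: I_def)
    obtain p q where "p \<in> \<Phi> x" "coord (snd i) p < of_rat (fst i)" "q \<in> \<Phi> x" "of_rat (fst i) < coord (snd i) q"
      using x(1) unfolding V_def by blast
    then show "pt i \<in> \<Phi> x"
      unfolding pt_def using pos
      by (intro connectedin_hedgehog_IVT[OF \<Phi>_props(2)[OF x(2)], of p _ _ q]) auto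
    show "pt i \<notin> \<theta> x"
      using x(1) by (auto simp: V_def pt_def)
  qed
  \<comment> \<open>Each \<open>pt i\<close> is added on the closed set \<open>K i\<close>: the
    points of X where \<theta>' meets a closed set gain a locally finite union of sets
    \<open>K i\<close>, so \<theta>' stays u.s.c., and each value gains finitely many points, so it
    stays compact.\<close>
  define \<theta>' where "\<theta>' x = \<theta> x \<union> pt ` {i \<in> I. x \<in> K i}" for x
  interpret hedgehog_sandwich X A \<Phi> \<theta>'
  proof
    fix x assume x: "x \<in> topspace X"
    show "\<theta>' x \<noteq> {}"
      using \<theta>_props(2)[OF x] by (simp add: \<theta>'_def)
    show sub: "\<theta>' x \<subseteq> \<Phi> x"
      using \<theta>_props(3)[OF x] pt_\<Phi> by (auto simp: \<theta>'_def)
    obtain N where N: "x \<in> N" "finite {i \<in> I. K i \<inter> N \<noteq> {}}"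
      by (rule locally_finite_familyD[OF K(4) x])
    have "{i \<in> I. x \<in> K i} \<subseteq> {i \<in> I. K i \<inter> N \<noteq> {}}"
      using N(1) by blast
    then have "finite (pt ` {i \<in> I. x \<in> K i})"
      using N(2) finite_subset by blast
    moreover have "pt ` {i \<in> I. x \<in> K i} \<subseteq> topspace (hedgehog_space A)"
      using sub \<Phi>_props(3)[OF x] by (auto simp: \<theta>'_def topspace_hedgehog_space)
    ultimately have "compactin (hedgehog_space A) (pt ` {i \<in> I. x \<in> K i})"
      by (intro finite_imp_compactin)
    then show "compactin (hedgehog_space A) (\<theta>' x)"
      unfolding \<theta>'_def by (rule compactin_Un[OF \<theta>_props(1)[OF x]])
  next
    show "usc_map X (hedgehog_space A) \<theta>'"
      unfolding usc_map_def
    proof (intro allI impI)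
      fix F assume F: "closedin (hedgehog_space A) F"
      have "closedin X (\<Union>i\<in>{i \<in> I. pt i \<in> F}. K i)"
        by (intro closedin_UN_locally_finite locally_finite_family_mono[OF K(4)]) (use K(1) in auto)
      moreover have "closedin X {x \<in> topspace X. \<theta> x \<inter> F \<noteq> {}}"
        using \<theta>(2) F unfolding usc_map_def by blast
      moreover have "{x \<in> topspace X. \<theta>' x \<inter> F \<noteq> {}} =
          {x \<in> topspace X. \<theta> x \<inter> F \<noteq> {}} \<union> (\<Union>i\<in>{i \<in> I. pt i \<in> F}. K i)"
        using closedin_subset[OF K(1)] by (auto simp: \<theta>'_def)
      ultimately show "closedin X {x \<in> topspace X. \<theta>' x \<inter> F \<noteq> {}}"
        by (simp add: closedin_Un)
    qed
  qed (use X \<Phi>(2) \<Phi>_props in auto)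
  obtain \<phi> where \<phi>: "\<phi> \<in> topspace X \<rightarrow> compact_conn_hyp (hedgehog_space A)"
    "continuous_set_map X (hedgehog_space A) \<phi>" "\<forall>x\<in>topspace X. \<theta>' x \<subseteq> \<phi> x \<and> \<phi> x \<subseteq> \<Phi> x"
    using continuous_insertion[OF A X(2) \<tau>] by blast
  have "\<phi> x - \<theta> x \<noteq> {}" if x: "x \<in> topspace X" for x
  proof -
    obtain i where i: "i \<in> I" "x \<in> K i"
      using K(3) x by blast
    then have "pt i \<in> \<phi> x"
      using \<phi>(3) x by (auto simp: \<theta>'_def)
    then show ?thesis
      using pt_\<theta>[OF i] by blast
  qed
  moreover have "\<theta> x \<subseteq> \<phi> x" if "x \<in> topspace X" for x
    using \<phi>(3) that by (auto simp: \<theta>'_def)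
  ultimately show "\<exists>\<phi>. \<phi> \<in> topspace X \<rightarrow> compact_conn_hyp (hedgehog_space A) \<and>
      continuous_set_map X (hedgehog_space A) \<phi> \<and> selection_less X \<theta> \<phi> \<and> selection_le X \<phi> \<Phi>"
    using \<phi> by (intro exI[of _ \<phi>]) (simp add: selection_less_def selection_le_def)
qed

section \<open>Normality and paracompactness from strict insertion\<close>

lemma strict_insertionD:
  assumes "strict_insertion_property X A"
    and "\<And>x. x \<in> topspace X \<Longrightarrow> closedin (hedgehog_space A) (\<Phi> x)"
    and "\<And>x. x \<in> topspace X \<Longrightarrow> connectedin (hedgehog_space A) (\<Phi> x)"
    and "lsc_map X (hedgehog_space A) \<Phi>"
    and "\<And>x. x \<in> topspace X \<Longrightarrow> compactin (hedgehog_space A) (\<theta> x)"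
    and "\<And>x. x \<in> topspace X \<Longrightarrow> \<theta> x \<noteq> {}"
    and "usc_map X (hedgehog_space A) \<theta>"
    and "\<And>x. x \<in> topspace X \<Longrightarrow> \<theta> x \<subset> \<Phi> x"
  obtains \<phi> where "lsc_map X (hedgehog_space A) \<phi>" "usc_map X (hedgehog_space A) \<phi>"
    "\<And>x. x \<in> topspace X \<Longrightarrow> compactin (hedgehog_space A) (\<phi> x)"
    "\<And>x. x \<in> topspace X \<Longrightarrow> \<theta> x \<subset> \<phi> x" "\<And>x. x \<in> topspace X \<Longrightarrow> \<phi> x \<subseteq> \<Phi> x"
proof -
  have "\<Phi> \<in> topspace X \<rightarrow> closed_conn_hyp (hedgehog_space A)"
    using assms(2,3,6,8) by (force simp: closed_conn_hyp_def closed_hyp_def)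
  moreover have "\<theta> \<in> topspace X \<rightarrow> compact_hyp (hedgehog_space A)"
    using assms(5,6) by (auto simp: compact_hyp_def)
  moreover have "selection_less X \<theta> \<Phi>"
    using assms(8) by (force simp: selection_less_def selection_le_def)
  ultimately have "\<exists>\<phi>. \<phi> \<in> topspace X \<rightarrow> compact_conn_hyp (hedgehog_space A) \<and>
      continuous_set_map X (hedgehog_space A) \<phi> \<and> selection_less X \<theta> \<phi> \<and> selection_le X \<phi> \<Phi>"
    using assms(1,4,7) unfolding strict_insertion_property_def by blast
  then obtain \<phi> where \<phi>: "\<phi> \<in> topspace X \<rightarrow> compact_conn_hyp (hedgehog_space A)"
      "continuous_set_map X (hedgehog_space A) \<phi>" "selection_less X \<theta> \<phi>" "selection_le X \<phi> \<Phi>"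
    by blast
  show thesis
  proof (rule that[of \<phi>])
    show "lsc_map X (hedgehog_space A) \<phi>" "usc_map X (hedgehog_space A) \<phi>"
      using \<phi>(2) by (auto simp: continuous_set_map_def)
    fix x assume x: "x \<in> topspace X"
    show "compactin (hedgehog_space A) (\<phi> x)"
      using \<phi>(1) x by (auto simp: compact_conn_hyp_def compact_hyp_def)
    show "\<theta> x \<subset> \<phi> x"
      using \<phi>(3) x by (auto simp: selection_less_def selection_le_def)
    show "\<phi> x \<subseteq> \<Phi> x"
      using \<phi>(4) x by (simp add: selection_le_def)
  qed
qed

text \<open>On one spine \<Phi> shrinks to length 1/2 on the closed set G, hence is l.s.c., and
  \<theta> grows to length 3/4 on the closed set F, hence is u.s.c. Disjointness of F and G keeps
  \<theta> below \<Phi>; outside F strictness holds because even length 1/2 exceeds the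
  origin.\<close>

lemma strict_insertion_imp_normal:
  assumes ins: "strict_insertion_property X A" and A: "A \<noteq> {}"
  shows "normal_space X"
  unfolding normal_space_def
proof (intro allI impI, elim conjE)
  fix F G assume F: "closedin X F" and G: "closedin X G" and FG: "disjnt F G"
  obtain \<alpha> where \<alpha>: "\<alpha> \<in> A"
    using A by blast
  define L where "L t = spine_point \<alpha> ` {0..t}" for t
  define \<Phi> where "\<Phi> x = (if x \<in> G then L (1/2) else L 1)" for x
  define \<theta> where "\<theta> x = (if x \<in> F then L (3/4) else {Origin})" for x
  have L: "compactin (hedgehog_space A) (L t)" "connectedin (hedgehog_space A) (L t)" if "t \<le> 1" for t
    unfolding L_def using segment_compact_connected[OF \<alpha> that] .
  have L_mono: "L s \<subseteq> L t" if "s \<le> t" for s t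
    using that unfolding L_def by (intro image_mono) auto
  have L_Origin: "Origin \<in> L t" if "0 \<le> t" for t
    unfolding L_def using that by (intro image_eqI[of _ _ 0]) (auto simp: spine_point_def)
  have L_iff: "spine_point \<alpha> s \<in> L t \<longleftrightarrow> s \<le> t" if "0 \<le> s" for s t
    using that unfolding L_def by (auto simp: spine_point_def image_iff split: if_splits)
  have nz: "spine_point \<alpha> s \<noteq> Origin" if "0 < s" for s
    using that by (simp add: spine_point_def)
  obtain \<phi> where \<phi>: "lsc_map X (hedgehog_space A) \<phi>" "usc_map X (hedgehog_space A) \<phi>"
    "\<And>x. x \<in> topspace X \<Longrightarrow> compactin (hedgehog_space A) (\<phi> x)"
    "\<And>x. x \<in> topspace X \<Longrightarrow> \<theta> x \<subset> \<phi> x" "\<And>x. x \<in> topspace X \<Longrightarrow> \<phi> x \<subseteq> \<Phi> x"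
  proof (rule strict_insertionD[OF ins, of \<Phi> \<theta>])
    show "lsc_map X (hedgehog_space A) \<Phi>"
      unfolding lsc_map_def
    proof (intro allI impI)
      fix U assume "openin (hedgehog_space A) U"
      consider "L (1/2) \<inter> U \<noteq> {}" | "L (1/2) \<inter> U = {}" "L 1 \<inter> U \<noteq> {}" | "L 1 \<inter> U = {}"
        by blast
      then show "openin X {x \<in> topspace X. \<Phi> x \<inter> U \<noteq> {}}"
      proof cases
        case 1
        then have "{x \<in> topspace X. \<Phi> x \<inter> U \<noteq> {}} = topspace X"
          using L_mono[of "1/2" 1] by (auto simp: \<Phi>_def)
        then show ?thesis
          by simp
      next
        case 2
        then have "{x \<in> topspace X. \<Phi> x \<inter> U \<noteq> {}} = topspace X - G"
          by (auto simp: \<Phi>_def)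
        then show ?thesis
          using G by (simp add: closedin_def)
      next
        case 3
        then have "{x \<in> topspace X. \<Phi> x \<inter> U \<noteq> {}} = {}"
          using L_mono[of "1/2" 1] by (auto simp: \<Phi>_def split: if_splits)
        then show ?thesis
          by (metis openin_empty)
      qed
    qed
    show "usc_map X (hedgehog_space A) \<theta>"
      unfolding usc_map_def
    proof (intro allI impI)
      fix C assume "closedin (hedgehog_space A) C"
      consider "Origin \<in> C" | "Origin \<notin> C" "L (3/4) \<inter> C \<noteq> {}" | "Origin \<notin> C" "L (3/4) \<inter> C = {}"
        by blast
      then show "closedin X {x \<in> topspace X. \<theta> x \<inter> C \<noteq> {}}"
      proof cases
        case 1
        then have "{x \<in> topspace X. \<theta> x \<inter> C \<noteq> {}} = topspace X"
          using L_Origin[of "3/4"] by (auto simp: \<theta>_def)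
        then show ?thesis
          by simp
      next
        case 2
        then have "{x \<in> topspace X. \<theta> x \<inter> C \<noteq> {}} = F"
          using closedin_subset[OF F] by (auto simp: \<theta>_def split: if_splits)
        then show ?thesis
          using F by simp
      next
        case 3
        then have "{x \<in> topspace X. \<theta> x \<inter> C \<noteq> {}} = {}"
          by (auto simp: \<theta>_def split: if_splits)
        then show ?thesis
          by (metis closedin_empty)
      qed
    qed
    fix x assume "x \<in> topspace X"
    show "closedin (hedgehog_space A) (\<Phi> x)"
      unfolding \<Phi>_def using L(1) by (auto intro: compactin_imp_closedin[OF Hausdorff_hedgehog_space])
    show "connectedin (hedgehog_space A) (\<Phi> x)"
      unfolding \<Phi>_def using L(2) by auto
    show "compactin (hedgehog_space A) (\<theta> x)"
      unfolding \<theta>_def using L(1)[of "3/4"]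
      by (auto intro!: finite_imp_compactin simp: topspace_hedgehog_space)
    show "\<theta> x \<noteq> {}"
      using L_Origin[of "3/4"] by (auto simp: \<theta>_def)
    have notG: "x \<notin> G" if "x \<in> F"
      using FG that by (auto simp: disjnt_iff)
    show "\<theta> x \<subset> \<Phi> x"
    proof (cases "x \<in> F")
      case True
      have "spine_point \<alpha> 1 \<in> L 1" "spine_point \<alpha> 1 \<notin> L (3/4)"
        by (simp_all add: L_iff)
      then show ?thesis
        using True notG L_mono[of "3/4" 1] by (auto simp: \<theta>_def \<Phi>_def)
    next
      case False
      have "spine_point \<alpha> (1/2) \<in> \<Phi> x" "Origin \<in> \<Phi> x"
        using L_Origin[of 1] L_Origin[of "1/2"] by (auto simp: \<Phi>_def L_iff)
      then show ?thesis
        using False nz[of "1/2"] by (auto simp: \<theta>_def)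
    qed
  qed (rule that; assumption)
  have \<phi>_sub: "\<phi> x \<subseteq> hedgehog A" if "x \<in> topspace X" for x
    using compactin_subset_topspace[OF \<phi>(3)[OF that]] by (simp add: topspace_hedgehog_space)
  \<comment> \<open>5/8 is midway between the length 3/4 that \<phi> x attains on F and the bound
    1/2 on G.\<close>
  let ?U = "{x \<in> topspace X. \<phi> x \<inter> {p \<in> hedgehog A. 5/8 < coord \<alpha> p} \<noteq> {}}"
  let ?V = "{x \<in> topspace X. \<phi> x \<subseteq> {p \<in> hedgehog A. coord \<alpha> p < 5/8}}"
  have "openin X ?U"
    by (rule lsc_map_openin_meets[OF \<phi>(1) openin_coord_greater])
  moreover have "openin X ?V"
    by (rule usc_map_openin_subset[OF \<phi>(2) openin_coord_less])
      (simp add: topspace_hedgehog_space \<phi>_sub)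
  moreover have "F \<subseteq> ?U"
  proof
    fix x assume x: "x \<in> F"
    then have xX: "x \<in> topspace X"
      using closedin_subset[OF F] by blast
    have "spine_point \<alpha> (3/4) \<in> \<phi> x"
      using \<phi>(4)[OF xX] x L_iff[of "3/4" "3/4"] by (auto simp: \<theta>_def)
    then show "x \<in> ?U"
      using xX \<alpha> by (auto intro!: exI[of _ "spine_point \<alpha> (3/4)"])
  qed
  moreover have "G \<subseteq> ?V"
  proof
    fix x assume x: "x \<in> G"
    then have xX: "x \<in> topspace X"
      using closedin_subset[OF G] by blast
    have "\<phi> x \<subseteq> L (1/2)"
      using \<phi>(5)[OF xX] x by (simp add: \<Phi>_def)
    then have "coord \<alpha> p < 5/8" if "p \<in> \<phi> x" for p
      using that by (auto simp: L_def)
    then show "x \<in> ?V"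
      using xX \<phi>_sub[OF xX] by auto
  qed
  moreover have "\<not> (x \<in> ?U \<and> x \<in> ?V)" for x
    by force
  then have "disjnt ?U ?V"
    unfolding disjnt_iff by blast
  ultimately show "\<exists>U V. openin X U \<and> openin X V \<and> F \<subseteq> U \<and> G \<subseteq> V \<and> disjnt U V"
    by blast
qed

lemma strict_insertion_imp_card_paracompact:
  fixes \<tau> :: "'c rel" and A :: "'b set"
  assumes ins: "strict_insertion_property X A" and \<tau>: "\<tau> =o |A|" and A: "A \<noteq> {}"
  shows "card_paracompact_space \<tau> X"
  unfolding card_paracompact_space_def
proof (intro allI impI, elim conjE)
  fix \<U> assume \<U>: "\<forall>U\<in>\<U>. openin X U" "\<Union>\<U> = topspace X" "|\<U>| \<le>o \<tau>"
  show "\<exists>\<V>. (\<forall>V\<in>\<V>. openin X V) \<and> (\<forall>V\<in>\<V>. \<exists>U\<in>\<U>. V \<subseteq> U) \<and> \<Union>\<V> = topspace X \<and>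
      locally_finite_in X \<V>"
  proof (cases "\<U> = {}")
    case True
    then show ?thesis
      using \<U> by (intro exI[of _ "{}"]) (auto simp: locally_finite_in_def)
  next
    case False
    have "|\<U>| \<le>o |A|"
      using \<U>(3) \<tau> by (rule ordLeq_ordIso_trans)
    then have "\<exists>g. g ` A = \<U>"
      using card_of_ordLeq2[OF False, of A] by simp
    then obtain g where g: "g ` A = \<U>"
      by (elim exE)
    have open_g: "openin X (g \<alpha>)" if "\<alpha> \<in> A" for \<alpha>
      using \<U>(1) g that by blast
    \<comment> \<open>As each g \<alpha> is open, a spine present at x is present nearby, so \<Phi>
      is l.s.c. Its values may contain infinitely many full spines; they are closed but in general
      not compact.\<close>
    define \<Phi> where "\<Phi> x = star A (\<lambda>\<alpha>. if x \<in> g \<alpha> then 1 else 0)" for x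
    have Spine_\<Phi>: "Spine s \<alpha> \<in> \<Phi> x \<longleftrightarrow> \<alpha> \<in> A \<and> 0 < s \<and> s \<le> 1 \<and> x \<in> g \<alpha>" for s \<alpha> x
      by (auto simp: \<Phi>_def star_def)
    have Origin_\<Phi>: "Origin \<in> \<Phi> x" for x
      by (simp add: \<Phi>_def star_def)
    obtain \<phi> where \<phi>: "lsc_map X (hedgehog_space A) \<phi>" "usc_map X (hedgehog_space A) \<phi>"
      "\<And>x. x \<in> topspace X \<Longrightarrow> compactin (hedgehog_space A) (\<phi> x)"
      "\<And>x. x \<in> topspace X \<Longrightarrow> {Origin} \<subset> \<phi> x" "\<And>x. x \<in> topspace X \<Longrightarrow> \<phi> x \<subseteq> \<Phi> x"
    proof (rule strict_insertionD[OF ins, of \<Phi> "\<lambda>x. {Origin}"])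
      show "lsc_map X (hedgehog_space A) \<Phi>"
        unfolding lsc_map_def
      proof (intro allI impI)
        fix U assume U: "openin (hedgehog_space A) U"
        show "openin X {x \<in> topspace X. \<Phi> x \<inter> U \<noteq> {}}"
        proof (cases "Origin \<in> U")
          case True
          then have "{x \<in> topspace X. \<Phi> x \<inter> U \<noteq> {}} = topspace X"
            using Origin_\<Phi> by auto
          then show ?thesis
            by simp
        next
          case no: False
          have sub: "U \<subseteq> hedgehog A"
            using openin_subset[OF U] by (simp add: topspace_hedgehog_space)
          have "{x \<in> topspace X. \<Phi> x \<inter> U \<noteq> {}} = (\<Union>\<alpha>\<in>{\<alpha> \<in> A. \<exists>s. Spine s \<alpha> \<in> U}. g \<alpha>)" (is "?L = ?R")
          proof
            show "?L \<subseteq> ?R"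
            proof
              fix x assume "x \<in> ?L"
              then obtain p where p: "p \<in> \<Phi> x" "p \<in> U"
                by blast
              then obtain s \<alpha> where "p = Spine s \<alpha>"
                using no by (cases p) auto
              then show "x \<in> ?R"
                using p Spine_\<Phi> by auto
            qed
            show "?R \<subseteq> ?L"
            proof
              fix x assume "x \<in> ?R"
              then obtain s \<alpha> where s: "\<alpha> \<in> A" "Spine s \<alpha> \<in> U" "x \<in> g \<alpha>"
                by blast
              then have "Spine s \<alpha> \<in> \<Phi> x"
                using Spine_\<Phi> sub by auto
              then show "x \<in> ?L"
                using s openin_subset[OF open_g[OF s(1)]] by blast
            qed
          qed
          moreover have "openin X ?R"
            using open_g by (intro openin_Union) auto
          ultimately show ?thesis
            by simp
        qed
      qed
      show "usc_map X (hedgehog_space A) (\<lambda>x. {Origin})"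
      proof -
        have "closedin X {x \<in> topspace X. Origin \<in> F}" for F :: "'b hedgehog_point set"
          by (cases "Origin \<in> F") auto
        then show ?thesis
          unfolding usc_map_def by simp
      qed
      fix x assume x: "x \<in> topspace X"
      show "closedin (hedgehog_space A) (\<Phi> x)"
        unfolding \<Phi>_def by (rule closedin_star[OF A])
      show "connectedin (hedgehog_space A) (\<Phi> x)"
        unfolding \<Phi>_def by (rule connectedin_star[OF A]) auto
      show "compactin (hedgehog_space A) {Origin}"
        by (simp add: topspace_hedgehog_space)
      obtain \<alpha> where "\<alpha> \<in> A" "x \<in> g \<alpha>"
        using x \<U>(2) g by blast
      then have "Spine 1 \<alpha> \<in> \<Phi> x"
        by (simp add: Spine_\<Phi>)
      then show "{Origin} \<subset> \<Phi> x"
        using Origin_\<Phi> by blast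
      show "{Origin :: 'b hedgehog_point} \<noteq> {}"
        by simp
    qed (rule that; assumption)
    have \<phi>_sub: "\<phi> x \<subseteq> hedgehog A" if "x \<in> topspace X" for x
      using compactin_subset_topspace[OF \<phi>(3)[OF that]] by (simp add: topspace_hedgehog_space)
    have in_g: "x \<in> g \<alpha>" if x: "x \<in> topspace X" and p: "p \<in> \<phi> x" "0 < coord \<alpha> p" and \<alpha>: "\<alpha> \<in> A" for x p \<alpha>
    proof -
      have "p \<in> \<Phi> x"
        using \<phi>(5)[OF x] p(1) by blast
      then have "coord \<alpha> p \<le> (if x \<in> g \<alpha> then 1 else 0)"
        using \<alpha> by (simp add: \<Phi>_def star_def)
      then show ?thesis
        using p(2) by (auto split: if_splits)
    qed
    \<comment> \<open>A threshold t expresses the comparison with half the maximal height by two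
      open conditions: reaching above t, by lower semicontinuity, and staying below 2t, by upper
      semicontinuity.\<close>
    define W where "W \<alpha> t = {x \<in> topspace X. \<phi> x \<inter> {p \<in> hedgehog A. t < coord \<alpha> p} \<noteq> {}} \<inter>
        {x \<in> topspace X. \<phi> x \<subseteq> {p \<in> hedgehog A. height p < 2 * t}}" for \<alpha> t
    define V where "V \<alpha> = (\<Union>t\<in>{0<..}. W \<alpha> t)" for \<alpha>
    have "openin X (W \<alpha> t)" for \<alpha> t
      unfolding W_def
    proof (rule openin_Int)
      show "openin X {x \<in> topspace X. \<phi> x \<inter> {p \<in> hedgehog A. t < coord \<alpha> p} \<noteq> {}}"
        by (rule lsc_map_openin_meets[OF \<phi>(1) openin_coord_greater])
      show "openin X {x \<in> topspace X. \<phi> x \<subseteq> {p \<in> hedgehog A. height p < 2 * t}}"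
        by (rule usc_map_openin_subset[OF \<phi>(2) openin_height_less])
          (simp add: topspace_hedgehog_space \<phi>_sub)
    qed
    then have open_V: "openin X (V \<alpha>)" for \<alpha>
      unfolding V_def by (intro openin_Union) auto
    have V_sub: "V \<alpha> \<subseteq> g \<alpha>" if \<alpha>: "\<alpha> \<in> A" for \<alpha>
    proof
      fix x assume "x \<in> V \<alpha>"
      then obtain t p where "0 < t" "x \<in> topspace X" "p \<in> \<phi> x" "t < coord \<alpha> p"
        unfolding V_def W_def by blast
      then show "x \<in> g \<alpha>"
        using in_g[of x p \<alpha>] \<alpha> by simp
    qed
    have cover: "\<exists>\<alpha>\<in>A. x \<in> V \<alpha>" if x: "x \<in> topspace X" for x
    proof -
      obtain \<beta> where "\<beta> \<in> A"
        using A by blast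
      have "height ` \<phi> x = abs ` coord \<beta> ` \<phi> x"
        using abs_coord[of _ A \<beta>] \<phi>_sub[OF x] by (force simp: image_image)
      moreover have "compact (coord \<beta> ` \<phi> x)"
        using image_compactin[OF \<phi>(3)[OF x] continuous_map_coord] by simp
      then have "compact (abs ` coord \<beta> ` \<phi> x)"
        by (intro compact_continuous_image continuous_intros)
      ultimately have "compact (height ` \<phi> x)"
        by simp
      moreover have "height ` \<phi> x \<noteq> {}"
        using \<phi>(4)[OF x] by blast
      ultimately obtain p where p: "p \<in> \<phi> x" "\<forall>q\<in>\<phi> x. height q \<le> height p"
        using compact_attains_sup[of "height ` \<phi> x"] by blast
      obtain q where q: "q \<in> \<phi> x" "q \<noteq> Origin"
        using \<phi>(4)[OF x] by blast
      have "0 < height q"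
        using q \<phi>_sub[OF x] by (cases q) auto
      then have pos: "0 < height p"
        using p(2) q(1) by force
      then obtain s \<alpha> where s: "p = Spine s \<alpha>" "\<alpha> \<in> A" "height p = s"
        using p(1) \<phi>_sub[OF x] by (cases p) auto
      \<comment> \<open>With the maximal height s attained on \<alpha>, any t strictly between s/2
        and s would do; 2s/3 gives t < s < 2t.\<close>
      have "x \<in> W \<alpha> (2 / 3 * s)"
        unfolding W_def using x p s pos \<phi>_sub[OF x] by (force simp: subset_iff)
      then show ?thesis
        using s pos by (intro bexI[of _ \<alpha>]) (auto simp: V_def intro!: bexI[of _ "2 / 3 * s"])
    qed
    have lf: "locally_finite_family X A V"
      unfolding locally_finite_family_def
    proof
      fix x assume x: "x \<in> topspace X"
      obtain p where p: "p \<in> \<phi> x" "p \<noteq> Origin"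
        using \<phi>(4)[OF x] by blast
      then obtain s \<beta> where s: "p = Spine s \<beta>" "0 < s" "\<beta> \<in> A"
        using \<phi>_sub[OF x] by (cases p) auto
      \<comment> \<open>Any m strictly between 0 and s would do. By lower semicontinuity \<phi> y
        has points higher than m for y near x, so y in \<open>V \<alpha>\<close> forces 2t > m and a
        coordinate above m / 2 on \<alpha>, which only finitely many spines allow near x.\<close>
      define m where "m = s / 2"
      have m: "0 < m" "0 < m / 2" "m < s"
        using s by (auto simp: m_def)
      let ?N = "{y \<in> topspace X. \<phi> y \<inter> {q \<in> hedgehog A. m < coord \<beta> q} \<noteq> {}}"
      have N: "openin X ?N" "x \<in> ?N"
      proof -
        show "openin X ?N"
          by (rule lsc_map_openin_meets[OF \<phi>(1) openin_coord_greater])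
        have "p \<in> {q \<in> hedgehog A. m < coord \<beta> q}"
          using s m p \<phi>_sub[OF x] by auto
        then show "x \<in> ?N"
          using x p(1) by blast
      qed
      let ?E = "\<lambda>\<alpha>. {x \<in> topspace X. \<phi> x \<inter> {p \<in> hedgehog A. m / 2 \<le> coord \<alpha> p} \<noteq> {}}"
      have "locally_finite_family X A ?E"
        by (rule usc_compact_hedgehog_locally_finite[OF \<phi>(2,3) m(2)])
      then obtain M where M: "openin X M" "x \<in> M" "finite {\<alpha> \<in> A. ?E \<alpha> \<inter> M \<noteq> {}}"
        using x by (rule locally_finite_familyD)
      have "y \<in> ?E \<alpha>" if "y \<in> V \<alpha>" "y \<in> ?N" for y \<alpha>
      proof -
        obtain t where t: "y \<in> topspace X" "\<phi> y \<inter> {p \<in> hedgehog A. t < coord \<alpha> p} \<noteq> {}"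
          "\<phi> y \<subseteq> {p \<in> hedgehog A. height p < 2 * t}"
          using \<open>y \<in> V \<alpha>\<close> unfolding V_def W_def by blast
        obtain q where q: "q \<in> \<phi> y" "q \<in> hedgehog A" "m < coord \<beta> q"
          using \<open>y \<in> ?N\<close> by blast
        have "m < 2 * t"
          using coord_le_height[OF q(2), of \<beta>] q(1,3) t(3) by force
        then show ?thesis
          using t(1,2) by force
      qed
      then have "{\<alpha> \<in> A. V \<alpha> \<inter> (M \<inter> ?N) \<noteq> {}} \<subseteq> {\<alpha> \<in> A. ?E \<alpha> \<inter> M \<noteq> {}}"
        by blast
      then have "finite {\<alpha> \<in> A. V \<alpha> \<inter> (M \<inter> ?N) \<noteq> {}}"
        using M(3) by (rule finite_subset)
      then show "\<exists>N. openin X N \<and> x \<in> N \<and> finite {\<alpha> \<in> A. V \<alpha> \<inter> N \<noteq> {}}"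
        using M N by (intro exI[of _ "M \<inter> ?N"]) auto
    qed
    have V_X: "V \<alpha> \<subseteq> topspace X" for \<alpha>
      by (rule openin_subset[OF open_V])
    show ?thesis
    proof (intro exI[of _ "V ` A"] conjI)
      show "\<forall>U\<in>V ` A. openin X U"
        using open_V by blast
      show "\<forall>U\<in>V ` A. \<exists>W\<in>\<U>. U \<subseteq> W"
        using V_sub g by blast
      show "\<Union> (V ` A) = topspace X"
        using V_X cover by blast
      show "locally_finite_in X (V ` A)"
        by (rule locally_finite_family_imp_locally_finite_in[OF lf V_X])
    qed
  qed
qed

theorem theorem1p1:
  fixes \<tau> :: "'c rel" and A :: "'b set" and X :: "'a topology"
  assumes "Cinfinite \<tau>"
    and "|A| =o \<tau>"
    and "Hausdorff_space X"
    and "infinite (topspace X)"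
  shows "(normal_space X \<and> card_paracompact_space \<tau> X) \<longleftrightarrow>
    (\<forall>\<Phi> \<theta>.
      \<Phi> \<in> topspace X \<rightarrow> closed_conn_hyp (hedgehog_space A) \<and>
      lsc_map X (hedgehog_space A) \<Phi> \<and>
      \<theta> \<in> topspace X \<rightarrow> compact_hyp (hedgehog_space A) \<and>
      usc_map X (hedgehog_space A) \<theta> \<and>
      selection_less X \<theta> \<Phi> \<longrightarrow>
      (\<exists>\<phi>. \<phi> \<in> topspace X \<rightarrow> compact_conn_hyp (hedgehog_space A) \<and>
        continuous_set_map X (hedgehog_space A) \<phi> \<and>
        selection_less X \<theta> \<phi> \<and> selection_le X \<phi> \<Phi>))"
proof -
  have A: "A \<noteq> {}"
  proof
    assume "A = {}"
    then have "finite (Field \<tau>)"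
      using assms(2) card_of_ordIso_finite_Field[of \<tau> "{}"] assms(1) ordIso_symmetric
      by (metis finite.emptyI)
    then show False
      using assms(1) by (simp add: cinfinite_def)
  qed
  have "|A| \<le>o \<tau>" "\<tau> =o |A|"
    using assms(2) ordIso_iff_ordLeq ordIso_symmetric by blast+
  then have "(normal_space X \<and> card_paracompact_space \<tau> X) \<longleftrightarrow> strict_insertion_property X A"
    using normal_card_paracompact_imp_strict_insertion[OF assms(1) _ A]
      strict_insertion_imp_normal[OF _ A] strict_insertion_imp_card_paracompact[OF _ _ A] by blast
  then show ?thesis
    unfolding strict_insertion_property_def .
qed

end
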